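(* Let $\mathcal U$, $\mathcal U'$ be Hopf algebroids over $k$, let $C$ be a cocommutative $k$-coalgebra and let $(\Psi,\psi):C\longrightarrow V(\mathcal U,\mathcal U')$ be a measuring of Hopf algebroids. Then for each $x\in C$ and each $n$, the induced maps are compatible with the Hopf-Galois maps: $$\overline\Psi^n(x)\circ\xi_n(\mathcal U)=\xi_n(\mathcal U')\circ\underline\Psi_n(x):C_n(\mathcal U)\longrightarrow C^n(\mathcal U').$$
   Context: $k$ is a field; $Vect_k(V,W)$ denotes the space of $k$-linear maps. Sweedler notation is used with summation suppressed. Left bialgebroid $(U,A_L,s_L,t_L,\Delta_L,\epsilon_L)$ over $k$ (write $A=A_L$): unital $k$-algebras $U,A$; $k$-algebra morphisms $s_L:A\to U$, $t_L:A^{op}\to U$ with commuting images; $U$ is an $(A,A)$-bimodule via $a\cdot u\cdot b=s_L(a)t_L(b)u$ and $U\otimes_{A_L}U$ is formed with this structure (so $t_L(a)u\otimes v=u\otimes s_L(a)v$); $(U,\Delta_L:U\to U\otimes_{A_L}U,\epsilon_L:U\to A_L)$ is a coalgebra in $(A,A)$-bimodules such that $\Delta_L$ takes values in $U\times_{A_L}U:=\{\sum u_i\otimes u_i' : \sum u_it_L(a)\otimes u'_i=\sum u_i\otimes u_i's_L(a)\ \forall a\in A\}$ (an algebra under factorwise multiplication), $\Delta_L:U\to U\times_{A_L}U$ is a unital algebra morphism, and $\epsilon_L(us_L(\epsilon_L(u')))=\epsilon_L(uu')=\epsilon_L(ut_L(\epsilon_L(u')))$. Hopf algebroid $\mathcal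 U=(U,A_L,s_L,t_L,\Delta_L,\epsilon_L,S)$: a left bialgebroid with an involutive ($S^2=\mathrm{id}$) anti-automorphism $S$ of the $k$-algebra $U$ with $S\circ t_L=s_L$ and, in $U\otimes_{A_L}U$ for all $u\in U$, $S(u_{(1)})_{(1)}u_{(2)}\otimes S(u_{(1)})_{(2)}=1_U\otimes S(u)$ and $S(u_{(2)})_{(1)}\otimes S(u_{(2)})_{(2)}u_{(1)}=S(u)\otimes 1_U$. Measuring of algebras: for $k$-algebras $R,R'$ and a $k$-coalgebra $C$ with counit $\epsilon_C$, a linear map $\psi:C\to Vect_k(R,R')$ with $\psi(x)(ab)=\psi(x_{(1)})(a)\psi(x_{(2)})(b)$ and $\psi(x)(1_R)=\epsilon_C(x)1_{R'}$. One writes $x(a)$ for $\psi(x)(a)$. Measuring of Hopf algebroids from $\mathcal U$ to $\mathcal U'$ by a cocommutative $k$-coalgebra $C$: a pair of algebra measurings $\Psi:C\to Vect_k(U,U')$, $\psi:C\to Vect_k(A_L,A'_L)$ such that for all $x\in C$: $\Psi(x)s_L=s_L'\psi(x)$, $\Psi(x)t_L=t'_L\psi(x)$, $\Psi(x)S=S'\Psi(x)$, $\psi(x)\epsilon_L=\epsilon_L'\Psi(x)$, and $\Delta'_L(\Psi(x)(u))=\Psi(x_{(1)})(u_{(1)})\otimes\Psi(x_{(2)})(u_{(2)})$ in $U'\otimes_{A'_L}U'$ for all $u\in U$. The map $(\Psi,\psi)$ takes values in $V(\mathcal U,\mathcal U'):=\{(F,f)\in Vect_k(U,U')\times Vect_k(A_L,A_L'):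 Fs_L=s_L'f,\ Ft_L=t_L'f,\ FS=S'F,\ f\epsilon_L=\epsilon_L'F\}$. $C^n(\mathcal U)=U\otimes_{A_L}\cdots\otimes_{A_L}U$ ($n$ factors, with bimodule structure $a\cdot u\cdot b=s_L(a)t_L(b)u$), $C^0(\mathcal U)=A_L$. $C_n(\mathcal U)=U\otimes_{A_R}\cdots\otimes_{A_R}U$ ($n$ factors), where $A_R=A_L^{op}$ and $U$ is an $(A_R,A_R)$-bimodule via $a\cdot u\cdot b=t_L(a)ut_L(b)$; $C_0(\mathcal U)=A_R$. The maps $\overline\Psi^n(x):C^n(\mathcal U)\to C^n(\mathcal U')$ and $\underline\Psi_n(x):C_n(\mathcal U)\to C_n(\mathcal U')$ are both given by $u^1\otimes\dots\otimes u^n\mapsto x_{(1)}(u^1)\otimes\dots\otimes x_{(n)}(u^n)$ (and by $\psi(x)$ for $n=0$). The Hopf-Galois map is the isomorphism $$\xi_n(\mathcal U):C_n(\mathcal U)\to C^n(\mathcal U),\quad u^1\otimes\dots\otimes u^n\mapsto u^1_{(1)}\otimes u^1_{(2)}u^2_{(1)}\otimes u^1_{(3)}u^2_{(2)}u^3_{(1)}\otimes\dots\otimes u^1_{(n)}u^2_{(n-1)}\cdots u^{n-1}_{(2)}u^n$$ (the identity of $A$ for $n=0$). *)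

theory Defs
  imports Complex_Main "HOL-Library.Poly_Mapping"
begin

section \<open>Tensor powers of a bimodule\<close>

text \<open>
  The \<open>n\<close>-fold tensor power of a bimodule \<open>M\<close> over a \<open>k\<close>-algebra is built in the textbook way: the
  free \<open>k\<close>-vector space on words of length \<open>n\<close> over \<open>M\<close>, modulo multilinearity and balancing.  The
  word \<open>[u\<^sub>1, \<dots>, u\<^sub>n]\<close> stands for \<open>u\<^sub>1 \<otimes> \<dots> \<otimes> u\<^sub>n\<close>; elements of the tensor power are equivalence
  classes of formal sums of words.

  Algebras have sort \<open>{ring, monoid_mult}\<close> rather than \<open>ring_1\<close>, since the latter excludes the
  zero ring.
\<close>

type_synonym ('k, 'u) fsum = "'u list \<Rightarrow>\<^sub>0 'k"

definition fscale :: "'k::field \<Rightarrow> ('k, 'u) fsum \<Rightarrow> ('k, 'u) fsum" where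
  "fscale c = Poly_Mapping.map ((*) c)"

lemma lookup_fscale [simp]: "Poly_Mapping.lookup (fscale c p) w = c * Poly_Mapping.lookup p w"
  by (simp add: fscale_def Poly_Mapping.map.rep_eq when_def)

global_interpretation fsum: vector_space fscale
  by standard (auto intro!: poly_mapping_eqI simp: lookup_add algebra_simps)

abbreviation word :: "'u list \<Rightarrow> ('k::field, 'u) fsum" where
  "word w \<equiv> Poly_Mapping.single w 1"

definition lin_ext :: "('k::field \<Rightarrow> 'b \<Rightarrow> 'b) \<Rightarrow> ('u list \<Rightarrow> 'b::ab_group_add) \<Rightarrow> ('k, 'u) fsum \<Rightarrow> 'b"
  where "lin_ext sc g p = (\<Sum>w\<in>Poly_Mapping.keys p. sc (Poly_Mapping.lookup p w) (g w))"

abbreviation flin :: "('u list \<Rightarrow> ('k, 'v) fsum) \<Rightarrow> ('k::field, 'u) fsum \<Rightarrow> ('k, 'v) fsum" where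
  "flin \<equiv> lin_ext fscale"

definition fbilin ::
  "('u list \<Rightarrow> 'v list \<Rightarrow> 'w list) \<Rightarrow> ('k::field, 'u) fsum \<Rightarrow> ('k, 'v) fsum \<Rightarrow> ('k, 'w) fsum" where
  "fbilin f p q = flin (\<lambda>v. flin (\<lambda>w. word (f v w)) q) p"

abbreviation fconcat :: "('k::field, 'u) fsum \<Rightarrow> ('k, 'u) fsum \<Rightarrow> ('k, 'u) fsum" where
  "fconcat \<equiv> fbilin append"

abbreviation fmult :: "('k::field, 'u::times) fsum \<Rightarrow> ('k, 'u) fsum \<Rightarrow> ('k, 'u) fsum" where
  "fmult \<equiv> fbilin (map2 (*))"

record ('k, 'a, 'u) bimod =
  scal :: "'k \<Rightarrow> 'u \<Rightarrow> 'u"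
  lact :: "'a \<Rightarrow> 'u \<Rightarrow> 'u"
  ract :: "'u \<Rightarrow> 'a \<Rightarrow> 'u"

definition tensor_relations ::
  "('k::field, 'a, 'u::ab_group_add) bimod \<Rightarrow> nat \<Rightarrow> ('k, 'u) fsum set" where
  "tensor_relations M n =
     {word (xs @ (u + v) # ys) - word (xs @ u # ys) - word (xs @ v # ys) | xs u v ys.
        length xs + 1 + length ys = n}
   \<union> {word (xs @ scal M c u # ys) - fscale c (word (xs @ u # ys)) | xs c u ys.
        length xs + 1 + length ys = n}
   \<union> {word (xs @ ract M u a # v # ys) - word (xs @ u # lact M a v # ys) | xs u a v ys.
        length xs + 2 + length ys = n}"

definition fsums :: "nat \<Rightarrow> ('k::field, 'u) fsum set" where
  "fsums n = {p. \<forall>w\<in>Poly_Mapping.keys p. length w = n}"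

definition tensor_eq ::
  "('k::field, 'a, 'u::ab_group_add) bimod \<Rightarrow> nat \<Rightarrow> (('k, 'u) fsum \<times> ('k, 'u) fsum) set" where
  "tensor_eq M n =
     {(p, q). p \<in> fsums n \<and> q \<in> fsums n \<and> p - q \<in> fsum.span (tensor_relations M n)}"

definition tensor_power ::
  "('k::field, 'a, 'u::ab_group_add) bimod \<Rightarrow> nat \<Rightarrow> ('k, 'u) fsum set set" where
  "tensor_power M n = fsums n // tensor_eq M n"

definition tclass ::
  "('k::field, 'a, 'u::ab_group_add) bimod \<Rightarrow> nat \<Rightarrow> ('k, 'u) fsum \<Rightarrow> ('k, 'u) fsum set" where
  "tclass M n p = tensor_eq M n `` {p}"

text \<open>
  A chosen representative.  For a comultiplication \<open>D\<close>, \<open>trep (D u)\<close> plays the role of the Sweedler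
  expression \<open>u\<^sub>(\<^sub>1\<^sub>) \<otimes> u\<^sub>(\<^sub>2\<^sub>)\<close>; below it is only ever used inside expressions whose value does not
  depend on the choice.
\<close>

definition trep :: "('k, 'u) fsum set \<Rightarrow> ('k, 'u) fsum" where
  "trep X = (SOME p. p \<in> X)"


section \<open>Algebras and coalgebras\<close>

locale k_algebra = vector_space sc
  for sc :: "'k::field \<Rightarrow> 'u::{ring, monoid_mult} \<Rightarrow> 'u" +
  assumes scale_mult_left: "sc c u * v = sc c (u * v)"
    and scale_mult_right: "u * sc c v = sc c (u * v)"

definition algebra_morphism ::
  "('k::field \<Rightarrow> 'u::{ring, monoid_mult} \<Rightarrow> 'u) \<Rightarrow> ('k \<Rightarrow> 'v::{ring, monoid_mult} \<Rightarrow> 'v) \<Rightarrow>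
    ('u \<Rightarrow> 'v) \<Rightarrow> bool" where
  "algebra_morphism sc sc' f \<longleftrightarrow>
     Vector_Spaces.linear sc sc' f \<and> f 1 = 1 \<and> (\<forall>a b. f (a * b) = f a * f b)"

definition algebra_antimorphism ::
  "('k::field \<Rightarrow> 'u::{ring, monoid_mult} \<Rightarrow> 'u) \<Rightarrow> ('k \<Rightarrow> 'v::{ring, monoid_mult} \<Rightarrow> 'v) \<Rightarrow>
    ('u \<Rightarrow> 'v) \<Rightarrow> bool" where
  "algebra_antimorphism sc sc' f \<longleftrightarrow>
     Vector_Spaces.linear sc sc' f \<and> f 1 = 1 \<and> (\<forall>a b. f (a * b) = f b * f a)"

text \<open>
  Coalgebras in the category of bimodules: the comultiplication \<open>D\<close> and the counit \<open>e\<close> are bimodule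
  maps satisfying coassociativity and the counit laws.  The bimodule structure of the tensor square
  is \<open>a \<cdot> (u \<otimes> v) \<cdot> b = (a \<cdot> u) \<otimes> (v \<cdot> b)\<close>.
\<close>

locale bimod_coalgebra =
  fixes M :: "('k::field, 'a::{ring, monoid_mult}, 'u::ab_group_add) bimod"
    and D :: "'u \<Rightarrow> ('k, 'u) fsum set"
    and e :: "'u \<Rightarrow> 'a"
  assumes comult_closed: "D u \<in> tensor_power M 2"
    and comult_add: "D (u + v) = tclass M 2 (trep (D u) + trep (D v))"
    and comult_scal: "D (scal M c u) = tclass M 2 (fscale c (trep (D u)))"
    and comult_lact: "D (lact M a u) = tclass M 2 (flin (\<lambda>w. word [lact M a (w ! 0), w ! 1]) (trep (D u)))"
    and comult_ract: "D (ract M u a) = tclass M 2 (flin (\<lambda>w. word [w ! 0, ract M (w ! 1) a]) (trep (D u)))"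
    and counit_add: "e (u + v) = e u + e v"
    and counit_lact: "e (lact M a u) = a * e u"
    and counit_ract: "e (ract M u a) = e u * a"
    and coassoc:
      "tclass M 3 (flin (\<lambda>w. fconcat (trep (D (w ! 0))) (word [w ! 1])) (trep (D u)))
       = tclass M 3 (flin (\<lambda>w. fconcat (word [w ! 0]) (trep (D (w ! 1)))) (trep (D u)))"
    and counit_left: "lin_ext (scal M) (\<lambda>w. lact M (e (w ! 0)) (w ! 1)) (trep (D u)) = u"
    and counit_right: "lin_ext (scal M) (\<lambda>w. ract M (w ! 0) (e (w ! 1))) (trep (D u)) = u"

text \<open>
  \<open>iter_comult D n u\<close> represents the iterated coproduct \<open>u\<^sub>(\<^sub>1\<^sub>) \<otimes> \<dots> \<otimes> u\<^sub>(\<^sub>n\<^sub>+\<^sub>1\<^sub>)\<close>, with \<open>n + 1\<close> legs.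
\<close>

primrec iter_comult :: "('u \<Rightarrow> ('k::field, 'u) fsum set) \<Rightarrow> nat \<Rightarrow> 'u \<Rightarrow> ('k, 'u) fsum" where
  "iter_comult D 0 u = word [u]"
| "iter_comult D (Suc n) u =
     flin (\<lambda>w. fconcat (word [w ! 0]) (iter_comult D n (w ! 1))) (trep (D u))"

record (overloaded) ('k, 'c) coalgebra_data =
  cscal :: "'k \<Rightarrow> 'c \<Rightarrow> 'c"
  ccomult :: "'c \<Rightarrow> ('k, 'c) fsum set"
  ccounit :: "'c \<Rightarrow> 'k"

definition k_bimod :: "('k \<Rightarrow> 'c \<Rightarrow> 'c) \<Rightarrow> ('k, 'k, 'c) bimod" where
  "k_bimod sc = \<lparr>scal = sc, lact = sc, ract = (\<lambda>x c. sc c x)\<rparr>"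

locale k_coalgebra = vector_space "cscal C" +
  bimod_coalgebra "k_bimod (cscal C)" "ccomult C" "ccounit C"
  for C :: "('k::field, 'c::ab_group_add) coalgebra_data"

locale cocommutative_coalgebra = k_coalgebra C
  for C :: "('k::field, 'c::ab_group_add) coalgebra_data" +
  assumes cocommutative:
    "ccomult C x = tclass (k_bimod (cscal C)) 2 (flin (\<lambda>w. word [w ! 1, w ! 0]) (trep (ccomult C x)))"


section \<open>Hopf algebroids\<close>

record (overloaded) ('k, 'u, 'a) bialgebroid_data =
  tot_scal :: "'k \<Rightarrow> 'u \<Rightarrow> 'u"
  base_scal :: "'k \<Rightarrow> 'a \<Rightarrow> 'a"
  src :: "'a \<Rightarrow> 'u"
  tgt :: "'a \<Rightarrow> 'u"
  comult :: "'u \<Rightarrow> ('k, 'u) fsum set"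
  counit :: "'u \<Rightarrow> 'a"

record (overloaded) ('k, 'u, 'a) hopf_algebroid_data = "('k, 'u, 'a) bialgebroid_data" +
  antipode :: "'u \<Rightarrow> 'u"

definition L_bimod ::
  "('k, 'u::times, 'a, 'z) bialgebroid_data_scheme \<Rightarrow> ('k, 'a, 'u) bimod" where
  "L_bimod H = \<lparr>scal = tot_scal H, lact = (\<lambda>a u. src H a * u), ract = (\<lambda>u a. tgt H a * u)\<rparr>"

text \<open>
  The bimodule over \<open>A\<^sub>R\<close>, the opposite of the base algebra.  Forming tensor powers involves only
  the two actions, so the base type need not be replaced by an opposite one.
\<close>

definition R_bimod ::
  "('k, 'u::times, 'a, 'z) bialgebroid_data_scheme \<Rightarrow> ('k, 'a, 'u) bimod" where
  "R_bimod H = \<lparr>scal = tot_scal H, lact = (\<lambda>a u. tgt H a * u), ract = (\<lambda>u a. u * tgt H a)\<rparr>"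

definition takeuchi_product ::
  "('k::field, 'u::{ring, monoid_mult}, 'a, 'z) bialgebroid_data_scheme \<Rightarrow> ('k, 'u) fsum set set" where
  "takeuchi_product H =
     {X \<in> tensor_power (L_bimod H) 2. \<forall>p\<in>X. \<forall>a.
        tclass (L_bimod H) 2 (flin (\<lambda>w. word [w ! 0 * tgt H a, w ! 1]) p)
        = tclass (L_bimod H) 2 (flin (\<lambda>w. word [w ! 0, w ! 1 * src H a]) p)}"

locale left_bialgebroid =
  U: k_algebra "tot_scal H" + A: k_algebra "base_scal H" +
  bimod_coalgebra "L_bimod H" "comult H" "counit H"
  for H :: "('k::field, 'u::{ring, monoid_mult}, 'a::{ring, monoid_mult}, 'z) bialgebroid_data_scheme" +
  assumes src_morphism: "algebra_morphism (base_scal H) (tot_scal H) (src H)"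
    and tgt_antimorphism: "algebra_antimorphism (base_scal H) (tot_scal H) (tgt H)"
    and src_tgt_commute: "src H a * tgt H b = tgt H b * src H a"
    and comult_takeuchi: "comult H u \<in> takeuchi_product H"
    and comult_one: "comult H 1 = tclass (L_bimod H) 2 (word [1, 1])"
    and comult_mult:
      "comult H (u * v) = tclass (L_bimod H) 2 (fmult (trep (comult H u)) (trep (comult H v)))"
    and counit_mult_src: "counit H (u * src H (counit H v)) = counit H (u * v)"
    and counit_mult_tgt: "counit H (u * tgt H (counit H v)) = counit H (u * v)"

locale hopf_algebroid = left_bialgebroid H
  for H :: "('k::field, 'u::{ring, monoid_mult}, 'a::{ring, monoid_mult}, 'z) hopf_algebroid_data_scheme" +
  assumes antipode_antimorphism: "algebra_antimorphism (tot_scal H) (tot_scal H) (antipode H)"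
    and antipode_involutive: "antipode H (antipode H u) = u"
    and antipode_tgt: "antipode H (tgt H a) = src H a"
    and antipode_left:
      "tclass (L_bimod H) 2
         (flin (\<lambda>w. flin (\<lambda>z. word [z ! 0 * w ! 1, z ! 1]) (trep (comult H (antipode H (w ! 0)))))
            (trep (comult H u)))
       = tclass (L_bimod H) 2 (word [1, antipode H u])"
    and antipode_right:
      "tclass (L_bimod H) 2
         (flin (\<lambda>w. flin (\<lambda>z. word [z ! 0, z ! 1 * w ! 0]) (trep (comult H (antipode H (w ! 1)))))
            (trep (comult H u)))
       = tclass (L_bimod H) 2 (word [antipode H u, 1])"


section \<open>Measurings\<close>

locale algebra_measuring =
  fixes C :: "('k::field, 'c::ab_group_add) coalgebra_data"
    and sc :: "'k \<Rightarrow> 'r::{ring, monoid_mult} \<Rightarrow> 'r"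
    and sc' :: "'k \<Rightarrow> 's::{ring, monoid_mult} \<Rightarrow> 's"
    and m :: "'c \<Rightarrow> 'r \<Rightarrow> 's"
  assumes measuring_linear: "Vector_Spaces.linear sc sc' (m x)"
    and measuring_add: "m (x + y) a = m x a + m y a"
    and measuring_scale: "m (cscal C c x) a = sc' c (m x a)"
    and measuring_mult: "m x (a * b) = lin_ext sc' (\<lambda>w. m (w ! 0) a * m (w ! 1) b) (trep (ccomult C x))"
    and measuring_one: "m x 1 = sc' (ccounit C x) 1"

definition V ::
  "('k::field, 'u::{ring, monoid_mult}, 'a::{ring, monoid_mult}) hopf_algebroid_data \<Rightarrow>
   ('k, 'v::{ring, monoid_mult}, 'b::{ring, monoid_mult}) hopf_algebroid_data \<Rightarrow>
   (('u \<Rightarrow> 'v) \<times> ('a \<Rightarrow> 'b)) set" where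
  "V H H' = {(F, f).
     Vector_Spaces.linear (tot_scal H) (tot_scal H') F \<and>
     Vector_Spaces.linear (base_scal H) (base_scal H') f \<and>
     (\<forall>a. F (src H a) = src H' (f a)) \<and>
     (\<forall>a. F (tgt H a) = tgt H' (f a)) \<and>
     (\<forall>u. F (antipode H u) = antipode H' (F u)) \<and>
     (\<forall>u. f (counit H u) = counit H' (F u))}"

locale hopf_measuring =
  total: algebra_measuring C "tot_scal H" "tot_scal H'" \<Psi> +
  base: algebra_measuring C "base_scal H" "base_scal H'" \<psi>
  for C :: "('k::field, 'c::ab_group_add) coalgebra_data"
    and H :: "('k, 'u::{ring, monoid_mult}, 'a::{ring, monoid_mult}) hopf_algebroid_data"
    and H' :: "('k, 'v::{ring, monoid_mult}, 'b::{ring, monoid_mult}) hopf_algebroid_data"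
    and \<Psi> :: "'c \<Rightarrow> 'u \<Rightarrow> 'v"
    and \<psi> :: "'c \<Rightarrow> 'a \<Rightarrow> 'b" +
  assumes measuring_in_V: "(\<Psi> x, \<psi> x) \<in> V H H'"
    and measuring_comult:
      "comult H' (\<Psi> x u)
       = tclass (L_bimod H') 2 (fbilin (map2 \<Psi>) (trep (ccomult C x)) (trep (comult H u)))"


section \<open>Chains, cochains and the Hopf-Galois map\<close>

text \<open>
  In degree 0 both spaces are the base algebra, which has a different type from the tensor powers
  occurring in positive degrees; hence the sum type.
\<close>

type_synonym ('k, 'u, 'a) chain = "'a + ('k, 'u) fsum set"

definition C_upper ::
  "('k::field, 'u::{ring, monoid_mult}, 'a) hopf_algebroid_data \<Rightarrow> nat \<Rightarrow> ('k, 'u, 'a) chain set" where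
  "C_upper H n = (if n = 0 then range Inl else Inr ` tensor_power (L_bimod H) n)"

definition C_lower ::
  "('k::field, 'u::{ring, monoid_mult}, 'a) hopf_algebroid_data \<Rightarrow> nat \<Rightarrow> ('k, 'u, 'a) chain set" where
  "C_lower H n = (if n = 0 then range Inl else Inr ` tensor_power (R_bimod H) n)"

text \<open>
  The map on classes induced by a map \<open>F\<close> of formal sums, in the style of the library theory
  \<open>Equiv_Relations\<close>.
\<close>

definition tinduced ::
  "('k::field, 'b, 'v::ab_group_add) bimod \<Rightarrow> nat \<Rightarrow> (('k, 'u) fsum \<Rightarrow> ('k, 'v) fsum) \<Rightarrow>
    ('k, 'u) fsum set \<Rightarrow> ('k, 'v) fsum set" where
  "tinduced M n F X = (\<Union>p\<in>X. tclass M n (F p))"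

text \<open>The formal sum representing \<open>x\<^sub>(\<^sub>1\<^sub>)(u\<^sub>1) \<otimes> \<dots> \<otimes> x\<^sub>(\<^sub>n\<^sub>)(u\<^sub>n)\<close>, extended linearly, for \<open>n \<ge> 1\<close>.\<close>

definition measure_fsum ::
  "('k::field, 'c) coalgebra_data \<Rightarrow> ('c \<Rightarrow> 'u \<Rightarrow> 'v) \<Rightarrow> nat \<Rightarrow> 'c \<Rightarrow> ('k, 'u) fsum \<Rightarrow> ('k, 'v) fsum" where
  "measure_fsum C \<Psi> n x p = fbilin (map2 \<Psi>) (iter_comult (ccomult C) (n - 1) x) p"

definition Psi_upper ::
  "('k::field, 'c) coalgebra_data \<Rightarrow> ('k, 'v::{ring, monoid_mult}, 'b) hopf_algebroid_data \<Rightarrow>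
   ('c \<Rightarrow> 'u \<Rightarrow> 'v) \<Rightarrow> ('c \<Rightarrow> 'a \<Rightarrow> 'b) \<Rightarrow> nat \<Rightarrow> 'c \<Rightarrow> ('k, 'u, 'a) chain \<Rightarrow> ('k, 'v, 'b) chain" where
  "Psi_upper C H' \<Psi> \<psi> n x = map_sum (\<psi> x) (tinduced (L_bimod H') n (measure_fsum C \<Psi> n x))"

definition Psi_lower ::
  "('k::field, 'c) coalgebra_data \<Rightarrow> ('k, 'v::{ring, monoid_mult}, 'b) hopf_algebroid_data \<Rightarrow>
   ('c \<Rightarrow> 'u \<Rightarrow> 'v) \<Rightarrow> ('c \<Rightarrow> 'a \<Rightarrow> 'b) \<Rightarrow> nat \<Rightarrow> 'c \<Rightarrow> ('k, 'u, 'a) chain \<Rightarrow> ('k, 'v, 'b) chain" where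
  "Psi_lower C H' \<Psi> \<psi> n x = map_sum (\<psi> x) (tinduced (R_bimod H') n (measure_fsum C \<Psi> n x))"

text \<open>
  The defining formula of the Hopf-Galois map is the factorwise product over \<open>i = 1, \<dots>, n\<close>, in this
  order, of \<open>1 \<otimes> \<dots> \<otimes> 1 \<otimes> u\<^sup>i\<^sub>(\<^sub>1\<^sub>) \<otimes> \<dots> \<otimes> u\<^sup>i\<^sub>(\<^sub>n\<^sub>-\<^sub>i\<^sub>+\<^sub>1\<^sub>)\<close> with \<open>i - 1\<close> leading units.
\<close>

primrec xi_word :: "('u \<Rightarrow> ('k::field, 'u::monoid_mult) fsum set) \<Rightarrow> 'u list \<Rightarrow> ('k, 'u) fsum" where
  "xi_word D [] = word []"
| "xi_word D (u # us) = fmult (iter_comult D (length us) u) (fconcat (word [1]) (xi_word D us))"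

definition xi ::
  "('k::field, 'u::{ring, monoid_mult}, 'a) hopf_algebroid_data \<Rightarrow> nat \<Rightarrow>
    ('k, 'u, 'a) chain \<Rightarrow> ('k, 'u, 'a) chain" where
  "xi H n = map_sum id (tinduced (L_bimod H) n (flin (xi_word (comult H))))"

end

theory Submission
  imports Defs
begin

text \<open>
  Both composites send \<open>u # us\<close> to the product of the iterated coproduct of \<open>x\<^sub>(\<^sub>1\<^sub>)(u)\<close> with
  \<open>1 \<otimes> \<xi>(x\<^sub>(\<^sub>2\<^sub>)(us))\<close>: by cocommutativity a measuring is multiplicative for factorwise products, it
  commutes with iterated coproducts, and \<open>x(1 \<otimes> q) = 1 \<otimes> x(q)\<close> by the counit law.  Multiplying by an
  iterated coproduct on the left preserves the relations of the tensor power because the iterated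
  coproduct lies in the Takeuchi product.  For the statement on classes it suffices that the
  measuring respects the relations over \<open>A\<^sub>L\<close> and that \<open>\<xi>\<close> of the target maps the relations over
  \<open>A\<^sub>R\<close> to those over \<open>A\<^sub>L\<close>.
\<close>

section \<open>Linear extension and tensor powers\<close>

text \<open>Two obstacles shape the proof. Sweedler legs come from \<open>trep\<close>, an arbitrary
  choice, so an iterated coproduct is linear only modulo the relations, and a Sweedler expression
  may be rewritten only once its integrand is known to be balanced. Many lemmas supply just this
  balance, and identities are stated after the projection \<open>tproj\<close>, placed inside the
  Sweedler sum. The other obstacle is an asymmetry of the factorwise product. Both actions of
  \<open>L_bimod\<close> are left multiplications, so the left factor may always be changed modulo
  the relations, the right one only if the left factor satisfies the Takeuchi condition. Over k both
  changes are harmless; hence a measuring is shown to be multiplicative over k first, and the result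
  is then carried over to the base algebra. Cocommutativity is used a second time for the descent of
  a measuring: in x(t(a)u \<otimes> v) the leg of x acting on t(a) has to pass the leg acting on
  u.\<close>

text \<open>
  Unlike \<open>Vector_Spaces.linear\<close>, this demands no vector space axioms, so it applies to the raw
  scalar multiplication of a bimodule record.
\<close>

definition klin ::
  "('k \<Rightarrow> 'x::ab_group_add \<Rightarrow> 'x) \<Rightarrow> ('k \<Rightarrow> 'y::ab_group_add \<Rightarrow> 'y) \<Rightarrow> ('x \<Rightarrow> 'y) \<Rightarrow> bool" where
  "klin sc sc' f \<longleftrightarrow> (\<forall>x y. f (x + y) = f x + f y) \<and> (\<forall>c x. f (sc c x) = sc' c (f x))"

lemma klin_add: "klin sc sc' f \<Longrightarrow> f (x + y) = f x + f y"
  by (simp add: klin_def)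

lemma klin_scale: "klin sc sc' f \<Longrightarrow> f (sc c x) = sc' c (f x)"
  by (simp add: klin_def)

lemma klin_zero: "klin sc sc' f \<Longrightarrow> f 0 = 0"
  using klin_add[of sc sc' f 0 0] by simp

lemma klin_diff: "klin sc sc' f \<Longrightarrow> f (x - y) = f x - f y"
  using klin_add[of sc sc' f "x - y" y] by simp

lemma klin_sum: "klin sc sc' f \<Longrightarrow> f (\<Sum>i\<in>I. g i) = (\<Sum>i\<in>I. f (g i))"
  by (induction I rule: infinite_finite_induct) (simp_all add: klin_zero klin_add)

lemma klin_comp: "klin sc' sc'' f \<Longrightarrow> klin sc sc' g \<Longrightarrow> klin sc sc'' (\<lambda>x. f (g x))"
  by (simp add: klin_def)

lemma klin_linear: "Vector_Spaces.linear sc sc' f \<Longrightarrow> klin sc sc' f"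
  by (simp add: klin_def Vector_Spaces.linear_iff)

lemma klin_lin_ext: "klin sc sc' f \<Longrightarrow> f (lin_ext sc g p) = lin_ext sc' (\<lambda>w. f (g w)) p"
  by (simp add: lin_ext_def klin_sum klin_scale)

lemma lin_ext_cong:
  "(\<And>w. w \<in> Poly_Mapping.keys p \<Longrightarrow> g w = h w) \<Longrightarrow> lin_ext sc g p = lin_ext sc h p"
  by (simp add: lin_ext_def)

context vector_space
begin

text \<open>Cancellation in \<open>p + q\<close> can shrink the support, so additivity of
  \<open>lin_ext\<close> needs its three sums over one common index set.\<close>

lemma lin_ext_superset:
  assumes "finite A" "Poly_Mapping.keys p \<subseteq> A"
  shows "lin_ext scale g p = (\<Sum>w\<in>A. Poly_Mapping.lookup p w *s g w)"
  unfolding lin_ext_def using assms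
  by (intro sum.mono_neutral_left) (auto simp: in_keys_iff)

lemma lin_ext_word: "lin_ext scale g (word w) = g w"
  by (simp add: lin_ext_def)

lemma klin_lin_ext_self: "klin fscale scale (lin_ext scale g)"
  unfolding klin_def
proof (intro conjI allI)
  fix p q :: "'c list \<Rightarrow>\<^sub>0 'a"
  let ?A = "Poly_Mapping.keys p \<union> Poly_Mapping.keys q"
  have "lin_ext scale g (p + q) = (\<Sum>w\<in>?A. Poly_Mapping.lookup (p + q) w *s g w)"
    by (rule lin_ext_superset) (use Poly_Mapping.keys_add[of p q] in auto)
  also have "\<dots> = (\<Sum>w\<in>?A. Poly_Mapping.lookup p w *s g w) + (\<Sum>w\<in>?A. Poly_Mapping.lookup q w *s g w)"
    by (simp add: lookup_add scale_left_distrib sum.distrib)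
  also have "\<dots> = lin_ext scale g p + lin_ext scale g q"
    by (subst (1 2) lin_ext_superset[of ?A]) auto
  finally show "lin_ext scale g (p + q) = lin_ext scale g p + lin_ext scale g q" .
next
  fix c and p :: "'c list \<Rightarrow>\<^sub>0 'a"
  have "lin_ext scale g (fscale c p) = (\<Sum>w\<in>Poly_Mapping.keys p. Poly_Mapping.lookup (fscale c p) w *s g w)"
    by (rule lin_ext_superset) (auto simp: in_keys_iff)
  then show "lin_ext scale g (fscale c p) = c *s lin_ext scale g p"
    by (simp add: lin_ext_def scale_sum_right)
qed

end

lemma klin_flin: "klin fscale fscale (flin g)"
  by (rule fsum.klin_lin_ext_self)

lemma klin_flin_comp: "klin sc fscale h \<Longrightarrow> klin sc fscale (\<lambda>x. flin g (h x))"
  by (rule klin_comp[OF klin_flin])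

lemma klin_flin_param_keys:
  "(\<And>w. w \<in> Poly_Mapping.keys p \<Longrightarrow> klin sc fscale (\<lambda>x. g x w)) \<Longrightarrow> klin sc fscale (\<lambda>x. flin (g x) p)"
  unfolding klin_def lin_ext_def
  by (auto simp: fsum.scale_right_distrib sum.distrib fsum.scale_sum_right mult.commute)

lemma klin_flin_param:
  "(\<And>w. klin sc fscale (\<lambda>x. g x w)) \<Longrightarrow> klin sc fscale (\<lambda>x. flin (g x) p)"
  by (rule klin_flin_param_keys)

lemma flin_word_arg [simp]: "flin g (word w) = g w"
  by (rule fsum.lin_ext_word)

lemma flin_flin: "flin g (flin h p) = flin (\<lambda>w. flin g (h w)) p"
  by (rule klin_lin_ext[OF klin_flin])

lemma flin_swap: "flin (\<lambda>v. flin (\<lambda>w. g v w) q) p = flin (\<lambda>w. flin (\<lambda>v. g v w) p) q"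
  unfolding lin_ext_def
  by (simp add: fsum.scale_sum_right mult.commute) (rule sum.swap)

lemma flin_word [simp]: "flin word p = p"
proof (rule poly_mapping_eqI)
  fix k
  have "Poly_Mapping.lookup (flin word p) k
      = (\<Sum>w\<in>Poly_Mapping.keys p. Poly_Mapping.lookup p w * Poly_Mapping.lookup (word w) k)"
    by (simp add: lin_ext_def lookup_sum)
  also have "\<dots> = (\<Sum>w\<in>Poly_Mapping.keys p. if w = k then Poly_Mapping.lookup p w else 0)"
    by (rule sum.cong) (auto simp: lookup_single)
  also have "\<dots> = Poly_Mapping.lookup p k"
    by (simp add: in_keys_iff)
  finally show "Poly_Mapping.lookup (flin word p) k = Poly_Mapping.lookup p k" .
qed

lemma klin_eq_flin: "klin fscale fscale F \<Longrightarrow> F p = flin (\<lambda>w. F (word w)) p"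
  using klin_lin_ext[of fscale fscale F word p] by simp

text \<open>Restricting to one word length keeps out the words on which \<open>map2\<close> would
  truncate or \<open>hd\<close> and \<open>last\<close> mean nothing.\<close>

lemma klin_fsums_eqI:
  assumes "klin fscale fscale F" "klin fscale fscale G" "p \<in> fsums n"
    and "\<And>w. length w = n \<Longrightarrow> F (word w) = G (word w)"
  shows "F p = G p"
  using assms by (subst (1 2) klin_eq_flin) (auto intro: lin_ext_cong simp: fsums_def)

lemma word_in_fsums [simp]: "word w \<in> fsums n \<longleftrightarrow> length w = n"
  by (simp add: fsums_def)

lemma fsums_subspace: "fsum.subspace (fsums n)"
  unfolding fsum.subspace_def fsums_def
  by (auto simp: in_keys_iff lookup_add)

lemma flin_in_fsums:
  assumes "\<And>w. w \<in> Poly_Mapping.keys p \<Longrightarrow> g w \<in> fsums n"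
  shows "flin g p \<in> fsums n"
  unfolding lin_ext_def using assms fsums_subspace
  by (intro fsum.subspace_sum fsum.subspace_scale) auto

lemma flin_in_fsums':
  assumes "p \<in> fsums m" "\<And>w. length w = m \<Longrightarrow> g w \<in> fsums n"
  shows "flin g p \<in> fsums n"
  using assms by (intro flin_in_fsums) (auto simp: fsums_def)

lemma flin_fsums_cong:
  assumes "p \<in> fsums n" "\<And>w. length w = n \<Longrightarrow> g w = h w"
  shows "lin_ext sc g p = lin_ext sc h p"
  using assms by (intro lin_ext_cong) (auto simp: fsums_def)

text \<open>Choose a basis of the span inside \<open>R\<close> and complete it to a basis of the
  whole space; \<open>f\<close> kills the former and fixes the added vectors. Idempotence makes
  \<open>f p\<close> a normal form of \<open>p\<close>, so congruences can be handled as equations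
  between formal sums.\<close>

lemma ex_klin_kernel:
  fixes R :: "('k::field, 'u) fsum set"
  shows "\<exists>f :: ('k, 'u) fsum \<Rightarrow> ('k, 'u) fsum. klin fscale fscale f \<and>
    (\<forall>p. f p = 0 \<longleftrightarrow> p \<in> fsum.span R) \<and> (\<forall>p. f (f p) = f p)"
proof -
  interpret vp: vector_space_pair "fscale :: 'k \<Rightarrow> ('k, 'u) fsum \<Rightarrow> ('k, 'u) fsum" "fscale :: 'k \<Rightarrow> ('k, 'u) fsum \<Rightarrow> _" 
    by unfold_locales
  obtain B where B: "B \<subseteq> R" "fsum.independent B" "R \<subseteq> fsum.span B"
    by (rule fsum.maximal_independent_subset)
  have span: "fsum.span B = fsum.span R"
    using B by (metis fsum.span_mono fsum.span_span subset_antisym)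
  define B' where "B' = fsum.extend_basis B"
  have B': "fsum.independent B'" "B \<subseteq> B'" "fsum.span B' = UNIV"
    using fsum.independent_extend_basis fsum.extend_basis_superset fsum.span_extend_basis B(2)
    unfolding B'_def by auto
  define f where "f = vp.construct B' (\<lambda>b. if b \<in> B then 0 else b)"
  have lin: "Vector_Spaces.linear fscale fscale f"
    unfolding f_def by (rule vp.linear_construct[OF B'(1)])
  then interpret f: Vector_Spaces.linear fscale fscale f .
  have basis: "f b = (if b \<in> B then 0 else b)" if "b \<in> B'" for b
    unfolding f_def by (rule vp.construct_basis[OF B'(1) that])
  have zero: "f p = 0" if "p \<in> fsum.span B" for p
    using that by (rule f.eq_0_on_span[rotated]) (use basis B'(2) in auto)
  moreover have diff: "p - f p \<in> fsum.span B" for p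
  proof -
    have "p \<in> fsum.span B'" by (simp add: B'(3))
    then show ?thesis
    proof (induction rule: fsum.span_induct_alt)
      case base
      show ?case by (simp add: fsum.span_zero f.zero)
    next
      case (step c b q)
      have "b - f b \<in> fsum.span B"
        using step basis by (auto simp: fsum.span_zero intro: fsum.span_base)
      moreover have "fscale c b + q - f (fscale c b + q) = fscale c (b - f b) + (q - f q)"
        by (simp add: f.add f.scale fsum.scale_right_diff_distrib)
      ultimately show ?case
        using step by (metis fsum.span_add fsum.span_scale)
    qed
  qed
  ultimately have "f p = 0 \<longleftrightarrow> p \<in> fsum.span R" for p
    unfolding span[symmetric] by (metis diff_zero)
  moreover have "f (f p) = f p" for p
    using zero[OF diff[of p]] by (simp add: f.diff)
  ultimately show ?thesis
    using klin_linear[OF lin] by blast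
qed

text \<open>
  Since \<open>tproj M n\<close> is a linear projection whose kernel is spanned by the relations, congruence in
  the tensor power is equality of images under \<open>tproj M n\<close>.
\<close>

definition tproj ::
  "('k::field, 'a, 'u::ab_group_add) bimod \<Rightarrow> nat \<Rightarrow> ('k, 'u) fsum \<Rightarrow> ('k, 'u) fsum" where
  "tproj M n = (SOME f. klin fscale fscale f \<and>
    (\<forall>p. f p = 0 \<longleftrightarrow> p \<in> fsum.span (tensor_relations M n)) \<and> (\<forall>p. f (f p) = f p))"

lemma klin_tproj: "klin fscale fscale (tproj M n)"
  and tproj_eq_0_iff: "tproj M n p = 0 \<longleftrightarrow> p \<in> fsum.span (tensor_relations M n)"
  and tproj_tproj: "tproj M n (tproj M n p) = tproj M n p"
  using someI_ex[OF ex_klin_kernel[of "tensor_relations M n"]] unfolding tproj_def[symmetric] by auto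

lemma klin_tproj_comp: "klin sc fscale h \<Longrightarrow> klin sc fscale (\<lambda>x. tproj M n (h x))"
  by (rule klin_comp[OF klin_tproj])

lemma tproj_eq_iff: "tproj M n p = tproj M n q \<longleftrightarrow> p - q \<in> fsum.span (tensor_relations M n)"
  using tproj_eq_0_iff[of M n "p - q"] by (simp add: klin_diff[OF klin_tproj])

lemma tensor_eq_iff:
  "(p, q) \<in> tensor_eq M n \<longleftrightarrow> p \<in> fsums n \<and> q \<in> fsums n \<and> tproj M n p = tproj M n q"
  by (simp add: tensor_eq_def tproj_eq_iff)

lemma tclass_eqI:
  assumes "p \<in> fsums n" "q \<in> fsums n" "tproj M n p = tproj M n q"
  shows "tclass M n p = tclass M n q"
  using assms by (auto simp: tclass_def tensor_eq_iff)

lemma tclass_eqD: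
  assumes "tclass M n p = tclass M n q" "p \<in> fsums n"
  shows "tproj M n p = tproj M n q"
proof -
  have "p \<in> tclass M n p" using assms(2) by (simp add: tclass_def tensor_eq_iff)
  then show ?thesis unfolding assms(1) by (simp add: tclass_def tensor_eq_iff)
qed

lemma tensor_powerE:
  assumes "X \<in> tensor_power M n"
  obtains p where "p \<in> fsums n" "X = tclass M n p"
  using assms by (auto simp: tensor_power_def quotient_def tclass_def)

lemma trep_in: "X \<in> tensor_power M n \<Longrightarrow> trep X \<in> X"
  unfolding trep_def by (rule someI_ex) (auto elim!: tensor_powerE simp: tclass_def tensor_eq_iff)

lemma tensor_power_subset: "X \<in> tensor_power M n \<Longrightarrow> X \<subseteq> fsums n"
  by (auto elim!: tensor_powerE simp: tclass_def tensor_eq_iff)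

lemma trep_fsums: "X \<in> tensor_power M n \<Longrightarrow> trep X \<in> fsums n"
  using trep_in tensor_power_subset by blast

lemma tproj_trep_tclass:
  assumes "tclass M n p \<in> tensor_power M n"
  shows "tproj M n (trep (tclass M n p)) = tproj M n p"
  using trep_in[OF assms] by (simp add: tclass_def tensor_eq_iff)

text \<open>\<open>balanced M n G\<close>: the linear extension of \<open>G\<close> descends to the \<open>n\<close>-th tensor power of \<open>M\<close>.\<close>

primrec balanced ::
  "('k::field, 'a, 'u::ab_group_add) bimod \<Rightarrow> nat \<Rightarrow> ('u list \<Rightarrow> ('k, 'v) fsum) \<Rightarrow> bool" where
  "balanced M 0 G \<longleftrightarrow> True"
| "balanced M (Suc n) G \<longleftrightarrow>
     (\<forall>ys. length ys = n \<longrightarrow> klin (scal M) fscale (\<lambda>u. G (u # ys)))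
   \<and> (\<forall>u a v ys. Suc (length ys) = n \<longrightarrow> G (ract M u a # v # ys) = G (u # lact M a v # ys))
   \<and> (\<forall>u. balanced M n (\<lambda>w. G (u # w)))"

text \<open>\<open>balanced\<close> speaks of the front slots only; deeper slots are reached by
  fixing the letters of \<open>xs\<close> one at a time.\<close>

lemma balanced_klin:
  "balanced M n G \<Longrightarrow> Suc (length xs + length ys) = n \<Longrightarrow> klin (scal M) fscale (\<lambda>u. G (xs @ u # ys))"
proof (induction xs arbitrary: n G)
  case (Cons x xs)
  then obtain m where "n = Suc m" by (cases n) auto
  with Cons.IH[of m "\<lambda>w. G (x # w)"] Cons.prems show ?case by simp
qed auto

lemma balanced_swap:
  "balanced M n G \<Longrightarrow> length xs + length ys + 2 = n \<Longrightarrow>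
    G (xs @ ract M u a # v # ys) = G (xs @ u # lact M a v # ys)"
proof (induction xs arbitrary: n G)
  case (Cons x xs)
  then obtain m where "n = Suc m" by (cases n) auto
  with Cons.IH[of m "\<lambda>w. G (x # w)"] Cons.prems show ?case by simp
qed auto

text \<open>Universal property of the tensor power: \<open>flin G\<close> vanishes on each of the
  three kinds of generators, and its kernel is a subspace.\<close>

lemma flin_tproj_eq:
  assumes "balanced M n G" "tproj M n p = tproj M n q"
  shows "flin G p = flin G q"
proof -
  note d = klin_diff[OF klin_flin] klin_scale[OF klin_flin]
  have "flin G r = 0" if "r \<in> tensor_relations M n" for r
    using that balanced_swap[OF assms(1)]
      klin_add[OF balanced_klin[OF assms(1)]] klin_scale[OF balanced_klin[OF assms(1)]]
    unfolding tensor_relations_def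
    by (auto simp: d)
  then have "tensor_relations M n \<subseteq> {r. flin G r = 0}" by auto
  moreover have "fsum.subspace {r. flin G r = 0}"
    by (simp add: fsum.subspace_def klin_zero[OF klin_flin] klin_add[OF klin_flin] klin_scale[OF klin_flin])
  ultimately have "fsum.span (tensor_relations M n) \<subseteq> {r. flin G r = 0}"
    by (rule fsum.span_minimal)
  then show ?thesis
    using assms(2) klin_diff[OF klin_flin, of G p q] by (auto simp: tproj_eq_iff)
qed

lemma tproj_add_word:
  "length xs + 1 + length ys = n \<Longrightarrow>
    tproj M n (word (xs @ (u + v) # ys)) = tproj M n (word (xs @ u # ys)) + tproj M n (word (xs @ v # ys))"
  unfolding klin_add[OF klin_tproj, symmetric] tproj_eq_iff diff_diff_eq[symmetric]
  by (rule fsum.span_base) (unfold tensor_relations_def, blast)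

lemma tproj_scale_word:
  "length xs + 1 + length ys = n \<Longrightarrow>
    tproj M n (word (xs @ scal M c u # ys)) = fscale c (tproj M n (word (xs @ u # ys)))"
  unfolding klin_scale[OF klin_tproj, symmetric] tproj_eq_iff
  by (rule fsum.span_base) (unfold tensor_relations_def, blast)

lemma tproj_swap_word:
  "length xs + 2 + length ys = n \<Longrightarrow>
    tproj M n (word (xs @ ract M u a # v # ys)) = tproj M n (word (xs @ u # lact M a v # ys))"
  unfolding tproj_eq_iff
  by (rule fsum.span_base) (unfold tensor_relations_def, blast)

text \<open>The prefix carries the induction: the last clause of \<open>balanced\<close> freezes the
  front letter, which then joins \<open>xs\<close>. With no prefix this is the canonical multilinear
  map into the tensor power.\<close>

lemma balanced_tproj_prefix: "balanced M n (\<lambda>w. tproj M (length xs + n) (word (xs @ w)))"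
proof (induction n arbitrary: xs)
  case (Suc n)
  have "balanced M n (\<lambda>w. tproj M (Suc (length xs + n)) (word (xs @ u # w)))" for u
    using Suc[of "xs @ [u]"] by simp
  then show ?case
    by (auto simp: klin_def tproj_add_word tproj_scale_word tproj_swap_word)
qed simp

lemma balanced_tproj: "balanced M n (\<lambda>w. tproj M n (word w))"
  using balanced_tproj_prefix[of M n "[]"] by simp

lemma balanced_cong:
  assumes "\<And>w. length w = n \<Longrightarrow> G w = G' w"
  shows "balanced M n G \<longleftrightarrow> balanced M n G'"
  using assms
proof (induction n arbitrary: G G')
  case (Suc n)
  have "balanced M n (\<lambda>w. G (u # w)) \<longleftrightarrow> balanced M n (\<lambda>w. G' (u # w))" for u
    by (rule Suc.IH) (simp add: Suc.prems)
  then show ?case using Suc.prems by (simp add: klin_def)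
qed simp

lemma balanced_klin_comp: "klin fscale fscale F \<Longrightarrow> balanced M n G \<Longrightarrow> balanced M n (\<lambda>w. F (G w))"
  by (induction n arbitrary: G) (auto intro: klin_comp)

lemma balanced_flin_param:
  "(\<And>i. i \<in> Poly_Mapping.keys p \<Longrightarrow> balanced M n (G i)) \<Longrightarrow> balanced M n (\<lambda>w. flin (\<lambda>i. G i w) p)"
  by (induction n arbitrary: G) (auto intro!: klin_flin_param_keys lin_ext_cong)

lemma tproj_flin_eq_flin_tproj: "tproj M n (flin g p) = flin (\<lambda>w. tproj M n (g w)) p"
  by (rule klin_lin_ext[OF klin_tproj])

lemma klin_tproj_cong:
  assumes "klin fscale fscale F" "balanced M n (\<lambda>w. F (word w))" "tproj M n p = tproj M n q"
  shows "F p = F q"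
  using flin_tproj_eq[OF assms(2,3)] klin_eq_flin[OF assms(1)] by metis

lemma tproj_factor:
  assumes "klin fscale fscale F" "balanced M n (\<lambda>w. F (word w))"
  shows "F p = F (tproj M n p)"
  by (rule klin_tproj_cong[OF assms]) (simp add: tproj_tproj)

text \<open>As a formal sum \<open>h x\<close> need not be linear in \<open>x\<close>, typically
  because it is built from \<open>trep\<close>. A map \<open>F\<close> that descends to the tensor
  power sees only the class, and there linearity holds.\<close>

lemma klin_tproj_factor:
  assumes "klin fscale fscale F" "balanced M n (\<lambda>w. F (word w))" "klin sc fscale (\<lambda>x. tproj M n (h x))"
  shows "klin sc fscale (\<lambda>x. F (h x))"
  unfolding tproj_factor[OF assms(1,2), of "h _"] by (rule klin_comp[OF assms(1,3)])

lemma balanced_tproj_factor: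
  assumes "klin fscale fscale F" "balanced M m (\<lambda>w. F (word w))" "balanced N n (\<lambda>w. tproj M m (h w))"
  shows "balanced N n (\<lambda>w. F (h w))"
  unfolding tproj_factor[OF assms(1,2), of "h _"] by (rule balanced_klin_comp[OF assms(1,3)])

section \<open>Words and factorwise products\<close>

definition fcons :: "'u \<Rightarrow> ('k::field, 'u) fsum \<Rightarrow> ('k, 'u) fsum" where
  "fcons v = flin (\<lambda>w. word (v # w))"

text \<open>With \<open>f = lact M a\<close> this is the outer left action on the tensor power;
  \<open>map_last\<close> gives the outer right action in the same way.\<close>

definition map_head :: "('u \<Rightarrow> 'u) \<Rightarrow> ('k::field, 'u) fsum \<Rightarrow> ('k, 'u) fsum" where
  "map_head f = flin (\<lambda>w. word (f (hd w) # tl w))"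

definition map_last :: "('u \<Rightarrow> 'u) \<Rightarrow> ('k::field, 'u) fsum \<Rightarrow> ('k, 'u) fsum" where
  "map_last f = flin (\<lambda>w. word (butlast w @ [f (last w)]))"

lemma fconcat_word_Cons: "fconcat (word [v]) p = fcons v p"
  by (simp add: fbilin_def fcons_def)

lemma klin_fcons: "klin fscale fscale (fcons v)"
  and klin_map_head: "klin fscale fscale (map_head f)"
  and klin_map_last: "klin fscale fscale (map_last f)"
  unfolding fcons_def map_head_def map_last_def by (rule klin_flin)+

lemma klin_fcons_comp: "klin sc fscale h \<Longrightarrow> klin sc fscale (\<lambda>x. fcons v (h x))"
  by (rule klin_comp[OF klin_fcons])

lemma fcons_word [simp]: "fcons v (word w) = word (v # w)"
  and map_head_word [simp]: "map_head f (word w) = word (f (hd w) # tl w)"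
  and map_last_word [simp]: "map_last f (word w) = word (butlast w @ [f (last w)])"
  by (simp_all add: fcons_def map_head_def map_last_def)

lemma fcons_in_fsums [intro]: "p \<in> fsums n \<Longrightarrow> fcons v p \<in> fsums (Suc n)"
  unfolding fcons_def by (rule flin_in_fsums') auto

lemma map_head_fcons: "map_head f (fcons v p) = fcons (f v) p"
  by (simp add: fcons_def map_head_def flin_flin)

lemma map_last_fcons:
  assumes "p \<in> fsums (Suc n)"
  shows "map_last f (fcons v p) = fcons v (map_last f p)"
  by (rule klin_fsums_eqI[OF _ _ assms])
    (auto intro: klin_comp[OF klin_map_last klin_fcons] klin_comp[OF klin_fcons klin_map_last])

lemma tproj_fcons_cong:
  assumes "tproj M n p = tproj M n q"
  shows "tproj M (Suc n) (fcons v p) = tproj M (Suc n) (fcons v q)"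
  by (rule klin_tproj_cong[OF klin_tproj_comp[OF klin_fcons] _ assms])
    (use balanced_tproj[of M "Suc n"] in simp)

lemma klin_tproj_fcons:
  assumes "p \<in> fsums n"
  shows "klin (scal M) fscale (\<lambda>v. tproj M (Suc n) (fcons v p))"
  unfolding fcons_def tproj_flin_eq_flin_tproj
  by (rule klin_flin_param_keys) (use assms balanced_tproj[of M "Suc n"] in \<open>auto simp: fsums_def\<close>)

lemma tproj_fcons_swap:
  fixes M :: "('k::field, 'a, 'u::ab_group_add) bimod"
  assumes "p \<in> fsums (Suc n)"
  shows "tproj M (Suc (Suc n)) (fcons (ract M u a) p)
    = tproj M (Suc (Suc n)) (fcons u (map_head (lact M a) p))"
proof (rule klin_fsums_eqI[OF _ _ assms])
  fix w :: "'u list" assume "length w = Suc n"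
  then obtain v ys where "w = v # ys" "length ys = n" by (cases w) auto
  then show "tproj M (Suc (Suc n)) (fcons (ract M u a) (word w))
    = tproj M (Suc (Suc n)) (fcons u (map_head (lact M a) (word w)))"
    using tproj_swap_word[of "[]" ys "Suc (Suc n)" M u a v] by simp
qed (intro klin_tproj_comp klin_fcons klin_fcons_comp klin_map_head)+

lemma fbilin_word [simp]: "fbilin f (word v) (word w) = word (f v w)"
  by (simp add: fbilin_def)

lemma klin_fbilin_left: "klin fscale fscale (\<lambda>p. fbilin f p q)"
  unfolding fbilin_def by (rule klin_flin)

lemma klin_fbilin_right: "klin fscale fscale (fbilin f p)"
  unfolding fbilin_def by (intro klin_flin_param klin_flin)

lemma klin_fbilin_left_comp: "klin sc fscale h \<Longrightarrow> klin sc fscale (\<lambda>x. fbilin f (h x) q)"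
  by (rule klin_comp[OF klin_fbilin_left])

lemma klin_fbilin_right_comp: "klin sc fscale h \<Longrightarrow> klin sc fscale (\<lambda>x. fbilin f p (h x))"
  by (rule klin_comp[OF klin_fbilin_right])

lemma fbilin_in_fsums:
  assumes "p \<in> fsums m" "q \<in> fsums n"
    and "\<And>v w. length v = m \<Longrightarrow> length w = n \<Longrightarrow> length (f v w) = l"
  shows "fbilin f p q \<in> fsums l"
  unfolding fbilin_def using assms by (auto intro!: flin_in_fsums')

lemma fmult_in_fsums: "p \<in> fsums n \<Longrightarrow> q \<in> fsums n \<Longrightarrow> fmult p q \<in> fsums n"
  by (rule fbilin_in_fsums) auto

lemma fbilin_map2_fcons:
  "fbilin (map2 f) (fcons a p) (fcons b q) = fcons (f a b) (fbilin (map2 f) p q)"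
proof -
  have 1: "fbilin (map2 f) (fcons a p) (fcons b (word w)) = fcons (f a b) (fbilin (map2 f) p (word w))" for w
  proof -
    have "fbilin (map2 f) (fcons a p) (fcons b (word w))
        = flin (\<lambda>v. fbilin (map2 f) (fcons a (word v)) (fcons b (word w))) p"
      by (rule klin_eq_flin) (intro klin_fbilin_left_comp klin_fcons)
    moreover have "fcons (f a b) (fbilin (map2 f) p (word w))
        = flin (\<lambda>v. fcons (f a b) (fbilin (map2 f) (word v) (word w))) p"
      by (rule klin_eq_flin) (intro klin_fcons_comp klin_fbilin_left)
    ultimately show ?thesis by simp
  qed
  have "fbilin (map2 f) (fcons a p) (fcons b q)
      = flin (\<lambda>w. fbilin (map2 f) (fcons a p) (fcons b (word w))) q"
    by (rule klin_eq_flin) (intro klin_fbilin_right_comp klin_fcons)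
  moreover have "fcons (f a b) (fbilin (map2 f) p q)
      = flin (\<lambda>w. fcons (f a b) (fbilin (map2 f) p (word w))) q"
    by (rule klin_eq_flin) (intro klin_fcons_comp klin_fbilin_right)
  ultimately show ?thesis using 1 by simp
qed

text \<open>Each \<open>z\<close> in \<open>zs\<close> contributes a bimodule map
  \<open>\<lambda>u. f u z\<close>, and a tensor product of bimodule maps respects the
  relations.\<close>

lemma balanced_map2:
  assumes "\<And>z. klin (scal M) (scal M) (\<lambda>u. f u z)"
    and "\<And>a u z. f (lact M a u) z = lact M a (f u z)"
    and "\<And>a u z. f (ract M u a) z = ract M (f u z) a"
    and "balanced M n G" "length zs = n"
  shows "balanced M n (\<lambda>w. G (map2 f w zs))"
  using assms(4,5)
proof (induction n arbitrary: G zs)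
  case (Suc n)
  obtain z zs' where zs: "zs = z # zs'" "length zs' = n" using Suc.prems(2) by (cases zs) auto
  have 1: "balanced M n (\<lambda>w. G (u # map2 f w zs'))" for u
    using Suc.IH[of "\<lambda>w. G (u # w)" zs'] Suc.prems zs by simp
  have 2: "klin (scal M) fscale (\<lambda>u. G (f u z # map2 f ys zs'))" if "length ys = n" for ys
    by (rule klin_comp[OF _ assms(1), where f = "\<lambda>u. G (u # _)"]) (use Suc.prems zs that in simp)
  have 3: "G (map2 f (ract M u a # v # ys) zs) = G (map2 f (u # lact M a v # ys) zs)"
    if ys: "Suc (length ys) = n" for u a v ys
  proof -
    obtain z' zs'' where "zs' = z' # zs''" using zs(2) ys by (cases zs') auto
    then show ?thesis using Suc.prems(1) zs ys by (simp add: assms(2,3))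
  qed
  show ?case unfolding balanced.simps using 1 2 3 by (simp add: zs)
qed simp

lemma balanced_tproj_fmult_left:
  fixes M :: "('k::field, 'a, 'u::{ring, monoid_mult}) bimod"
  assumes "\<And>v. klin (scal M) (scal M) (\<lambda>u. u * v)"
    and "\<And>a u v. lact M a u * v = lact M a (u * v)"
    and "\<And>a u v. ract M u a * v = ract M (u * v) a"
    and q: "q \<in> fsums n"
  shows "balanced M n (\<lambda>w. tproj M n (fmult (word w) q))"
proof -
  have "balanced M n (\<lambda>w. flin (\<lambda>z. tproj M n (word (map2 (*) w z))) q)"
    using q by (intro balanced_flin_param balanced_map2 assms balanced_tproj) (auto simp: fsums_def)
  then show ?thesis
    by (simp add: fbilin_def tproj_flin_eq_flin_tproj)
qed

lemma map2_flip: "map2 f xs ys = map2 (\<lambda>y x. f x y) ys xs"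
  by (simp add: zip_commute[of xs ys] case_prod_unfold)

text \<open>The hypotheses ask that both actions commute with left multiplication by
  \<open>v\<close>. Scalars of the field do so; the actions of \<open>L_bimod\<close>, being left
  multiplications themselves, in general do not.\<close>

lemma balanced_tproj_fmult_right:
  fixes M :: "('k::field, 'a, 'u::{ring, monoid_mult}) bimod"
  assumes "\<And>v. klin (scal M) (scal M) (\<lambda>u. v * u)"
    and "\<And>a u v. v * lact M a u = lact M a (v * u)"
    and "\<And>a u v. v * ract M u a = ract M (v * u) a"
    and p: "p \<in> fsums n"
  shows "balanced M n (\<lambda>w. tproj M n (fmult p (word w)))"
proof -
  have "balanced M n (\<lambda>w. flin (\<lambda>z. tproj M n (word (map2 (\<lambda>u v. v * u) w z))) p)"
    using p by (intro balanced_flin_param balanced_map2 assms balanced_tproj) (auto simp: fsums_def)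
  then show ?thesis
    by (simp add: fbilin_def tproj_flin_eq_flin_tproj map2_flip[of "\<lambda>u v. v * u"])
qed

lemma map_last_fmult:
  fixes b :: "'u::{ring, monoid_mult}"
  assumes "p \<in> fsums (Suc n)" "q \<in> fsums (Suc n)"
  shows "fmult (map_last (\<lambda>y. b * y) p) q = map_last (\<lambda>y. b * y) (fmult p q)"
proof (rule klin_fsums_eqI[OF _ _ assms(2)])
  fix w :: "'u list" assume w: "length w = Suc n"
  show "fmult (map_last (\<lambda>y. b * y) p) (word w) = map_last (\<lambda>y. b * y) (fmult p (word w))"
  proof (rule klin_fsums_eqI[OF _ _ assms(1)])
    fix v :: "'u list" assume v: "length v = Suc n"
    obtain ws y vs z where "w = ws @ [y]" "v = vs @ [z]" "length ws = n" "length vs = n"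
      using v w by (metis length_Suc_conv_rev)
    then show "fmult (map_last ((*) b) (word v)) (word w) = map_last ((*) b) (fmult (word v) (word w))"
      by (simp add: mult.assoc)
  qed (auto intro!: klin_fbilin_left klin_fbilin_left_comp klin_map_last klin_comp[OF klin_map_last])
qed (auto intro!: klin_fbilin_right klin_comp[OF klin_map_last])

section \<open>Sweedler sums\<close>

text \<open>The sum of g(u1, u2) over the legs of the coproduct. Its value does not depend on the
  choice made by \<open>trep\<close> as soon as \<open>g\<close> satisfies
  \<open>balanced2\<close>.\<close>

definition sweedler ::
  "('u \<Rightarrow> ('k::field, 'u) fsum set) \<Rightarrow> 'u \<Rightarrow> ('u \<Rightarrow> 'u \<Rightarrow> ('k, 'v) fsum) \<Rightarrow> ('k, 'v) fsum" where
  "sweedler D u g = flin (\<lambda>w. g (w ! 0) (w ! 1)) (trep (D u))"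

definition balanced2 ::
  "('k::field, 'a, 'u::ab_group_add) bimod \<Rightarrow> ('u \<Rightarrow> 'u \<Rightarrow> ('k, 'v) fsum) \<Rightarrow> bool" where
  "balanced2 M g \<longleftrightarrow> (\<forall>v. klin (scal M) fscale (\<lambda>u. g u v)) \<and> (\<forall>u. klin (scal M) fscale (g u))
     \<and> (\<forall>u a v. g (ract M u a) v = g u (lact M a v))"

lemma balanced2I:
  "(\<And>v. klin (scal M) fscale (\<lambda>u. g u v)) \<Longrightarrow> (\<And>u. klin (scal M) fscale (g u)) \<Longrightarrow>
    (\<And>u a v. g (ract M u a) v = g u (lact M a v)) \<Longrightarrow> balanced2 M g"
  by (simp add: balanced2_def)

lemma balanced2_balanced: "balanced2 M g \<Longrightarrow> balanced M 2 (\<lambda>w. g (w ! 0) (w ! 1))"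
  by (simp add: balanced2_def numeral_2_eq_2)

lemma sweedler_cong:
  assumes "\<And>v w. g v w = h v w"
  shows "sweedler D u g = sweedler D u h"
  using assms by (simp add: sweedler_def)

lemma klin_sweedler_comp:
  "klin fscale fscale F \<Longrightarrow> F (sweedler D u g) = sweedler D u (\<lambda>v w. F (g v w))"
  unfolding sweedler_def by (rule klin_lin_ext)

lemma klin_sweedler_param:
  "(\<And>v w. klin sc fscale (\<lambda>x. g x v w)) \<Longrightarrow> klin sc fscale (\<lambda>x. sweedler D u (g x))"
  unfolding sweedler_def by (rule klin_flin_param)

lemma sweedler_swap:
  "sweedler D u (\<lambda>a b. sweedler D' v (g a b)) = sweedler D' v (\<lambda>c d. sweedler D u (\<lambda>a b. g a b c d))"
  unfolding sweedler_def by (rule flin_swap)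

lemma sweedler_in_fsums: "(\<And>v w. g v w \<in> fsums n) \<Longrightarrow> sweedler D u g \<in> fsums n"
  unfolding sweedler_def by (rule flin_in_fsums) simp

lemma balanced_sweedler:
  "(\<And>v w. balanced M n (G v w)) \<Longrightarrow> balanced M n (\<lambda>us. sweedler D u (\<lambda>v w. G v w us))"
  unfolding sweedler_def by (rule balanced_flin_param)

lemma iter_comult_Suc: "iter_comult D (Suc n) u = sweedler D u (\<lambda>v w. fcons v (iter_comult D n w))"
  by (simp add: sweedler_def fconcat_word_Cons)

declare iter_comult.simps(2) [simp del]

lemma iter_comult_in_fsums: "iter_comult D n u \<in> fsums (Suc n)"
  by (induction n arbitrary: u) (auto simp: iter_comult_Suc intro!: sweedler_in_fsums)

lemma xi_word_Cons: "xi_word D (u # us) = fmult (iter_comult D (length us) u) (fcons 1 (xi_word D us))"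
  by (simp add: fconcat_word_Cons)

declare xi_word.simps(2) [simp del]

lemma xi_word_in_fsums: "xi_word D us \<in> fsums (length us)"
  by (induction us) (auto simp: xi_word_Cons intro!: fmult_in_fsums iter_comult_in_fsums)

context bimod_coalgebra
begin

lemma trep_comult_in_fsums: "trep (D u) \<in> fsums 2"
  by (rule trep_fsums[OF comult_closed])

lemma tproj_trep_comult: "D u = tclass M 2 p \<Longrightarrow> tproj M 2 (trep (D u)) = tproj M 2 p"
  using tproj_trep_tclass[of M 2 p] comult_closed[of u] by simp

text \<open>Any representative may replace \<open>trep\<close>. This turns each axiom of the form
  \<open>D u = tclass M 2 p\<close> into a rule for Sweedler sums.\<close>

lemma sweedler_tclass:
  assumes "balanced2 M g" "D u = tclass M 2 p"
  shows "sweedler D u g = flin (\<lambda>w. g (w ! 0) (w ! 1)) p"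
  unfolding sweedler_def
  by (rule flin_tproj_eq[OF balanced2_balanced[OF assms(1)] tproj_trep_comult[OF assms(2)]])

lemma klin_sweedler:
  assumes "balanced2 M g"
  shows "klin (scal M) fscale (\<lambda>u. sweedler D u g)"
  unfolding klin_def
  by (auto simp: sweedler_tclass[OF assms comult_add] sweedler_tclass[OF assms comult_scal]
      klin_add[OF klin_flin] klin_scale[OF klin_flin]) (simp_all add: sweedler_def)

lemma sweedler_lact:
  assumes "balanced2 M g"
  shows "sweedler D (lact M a u) g = sweedler D u (\<lambda>v w. g (lact M a v) w)"
  by (simp add: sweedler_tclass[OF assms comult_lact] flin_flin) (simp add: sweedler_def)

lemma sweedler_ract:
  assumes "balanced2 M g"
  shows "sweedler D (ract M u a) g = sweedler D u (\<lambda>v w. g v (ract M w a))"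
  by (simp add: sweedler_tclass[OF assms comult_ract] flin_flin) (simp add: sweedler_def)

end

section \<open>Legs of the measuring coalgebra: coassociativity, counit, cocommutativity\<close>

context k_coalgebra
begin

abbreviation Csum where "Csum \<equiv> sweedler (ccomult C)"
abbreviation Clin where "Clin \<equiv> klin (cscal C) fscale"

text \<open>Over the field bilinearity already contains the balancing condition: both sides are the
  scalar times the value of \<open>g\<close>.\<close>

lemma balanced2_k: "(\<And>y. Clin (\<lambda>x. g x y)) \<Longrightarrow> (\<And>x. Clin (g x)) \<Longrightarrow> balanced2 (k_bimod (cscal C)) g"
  by (simp add: balanced2_def k_bimod_def) (simp add: klin_def)

lemma Clin_Csum: "(\<And>y. Clin (\<lambda>x. g x y)) \<Longrightarrow> (\<And>x. Clin (g x)) \<Longrightarrow> Clin (\<lambda>x. Csum x g)"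
  using klin_sweedler[OF balanced2_k, of g] by (simp add: k_bimod_def)

text \<open>The axiom equates two classes in the third tensor power. Read as the function
  \<open>G\<close> on words of length three, a trilinear \<open>f\<close> is balanced and takes the
  same value on both representatives.\<close>

lemma Csum_coassoc:
  assumes "\<And>b c. Clin (\<lambda>a. f a b c)" "\<And>a c. Clin (\<lambda>b. f a b c)" "\<And>a b. Clin (\<lambda>c. f a b c)"
  shows "Csum x (\<lambda>p c. Csum p (\<lambda>a b. f a b c)) = Csum x (\<lambda>a p. Csum p (\<lambda>b c. f a b c))"
proof -
  define G where "G w = f (w ! 0) (w ! 1) (w ! 2)" for w
  let ?M = "k_bimod (cscal C)"
  have G: "balanced ?M 3 G"
    using assms unfolding G_def by (auto simp: numeral_3_eq_3 k_bimod_def klin_def)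
  define p where "p = flin (\<lambda>w. fconcat (trep (ccomult C (w ! 0))) (word [w ! 1])) (trep (ccomult C x))"
  define q where "q = flin (\<lambda>w. fconcat (word [w ! 0]) (trep (ccomult C (w ! 1)))) (trep (ccomult C x))"
  have "p \<in> fsums 3" unfolding p_def
    by (rule flin_in_fsums, rule fbilin_in_fsums[OF trep_comult_in_fsums, of _ 1]) auto
  then have "tproj ?M 3 p = tproj ?M 3 q"
    using coassoc unfolding p_def q_def by (intro tclass_eqD)
  then have "flin G p = flin G q" by (rule flin_tproj_eq[OF G])
  moreover have "flin G (fconcat (trep (ccomult C y)) (word [z])) = Csum y (\<lambda>a b. f a b z)" for y z
    unfolding sweedler_def fbilin_def flin_flin
    by (rule flin_fsums_cong[OF trep_comult_in_fsums]) (simp add: G_def nth_append)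
  then have "flin G p = Csum x (\<lambda>p c. Csum p (\<lambda>a b. f a b c))"
    unfolding p_def flin_flin by (simp add: sweedler_def)
  moreover have "flin G (fconcat (word [z]) (trep (ccomult C y))) = Csum y (\<lambda>b c. f z b c)" for y z
    unfolding sweedler_def fbilin_def flin_flin
    by (simp add: flin_flin) (simp add: G_def numeral_2_eq_2)
  then have "flin G q = Csum x (\<lambda>a p. Csum p (\<lambda>b c. f a b c))"
    unfolding q_def flin_flin by (simp add: sweedler_def)
  ultimately show ?thesis by simp
qed

lemma Csum_counit:
  assumes "Clin f"
  shows "Csum x (\<lambda>a b. fscale (ccounit C a) (f b)) = f x"
proof -
  have "f x = f (lin_ext (cscal C) (\<lambda>w. cscal C (ccounit C (w ! 0)) (w ! 1)) (trep (ccomult C x)))"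
    using counit_left[of x] by (simp add: k_bimod_def)
  then show ?thesis
    by (simp add: klin_lin_ext[OF assms] klin_scale[OF assms] sweedler_def)
qed

end

context cocommutative_coalgebra
begin

lemma Csum_cocommute:
  assumes "\<And>b. Clin (\<lambda>a. f a b)" "\<And>a. Clin (\<lambda>b. f a b)"
  shows "Csum x f = Csum x (\<lambda>a b. f b a)"
  by (subst sweedler_tclass[OF balanced2_k cocommutative])
    (auto simp: assms flin_flin sweedler_def)

text \<open>Bracketing to the left puts the first two legs under one coproduct, where they may be
  exchanged.\<close>

lemma Csum_swap12:
  assumes "\<And>b c. Clin (\<lambda>a. f a b c)" "\<And>a c. Clin (\<lambda>b. f a b c)" "\<And>a b. Clin (\<lambda>c. f a b c)"
  shows "Csum x (\<lambda>a p. Csum p (\<lambda>b c. f a b c)) = Csum x (\<lambda>a p. Csum p (\<lambda>b c. f b a c))"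
proof -
  have "Csum x (\<lambda>a p. Csum p (\<lambda>b c. f a b c)) = Csum x (\<lambda>p c. Csum p (\<lambda>a b. f a b c))"
    by (rule Csum_coassoc[symmetric]) (rule assms)+
  also have "\<dots> = Csum x (\<lambda>p c. Csum p (\<lambda>a b. f b a c))"
    by (intro sweedler_cong Csum_cocommute) (rule assms)+
  also have "\<dots> = Csum x (\<lambda>a p. Csum p (\<lambda>b c. f b a c))"
    by (rule Csum_coassoc) (rule assms)+
  finally show ?thesis .
qed

text \<open>The comultiplication of a cocommutative coalgebra is a coalgebra morphism. Bracketing
  the four legs to the right brings the middle two into the position treated by
  \<open>Csum_swap12\<close>.\<close>

lemma Csum_interchange:
  assumes "\<And>b c d. Clin (\<lambda>a. h a b c d)" "\<And>a c d. Clin (\<lambda>b. h a b c d)"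
    and "\<And>a b d. Clin (\<lambda>c. h a b c d)" "\<And>a b c. Clin (\<lambda>d. h a b c d)"
  shows "Csum x (\<lambda>p q. Csum p (\<lambda>a b. Csum q (\<lambda>c d. h a b c d)))
    = Csum x (\<lambda>p q. Csum p (\<lambda>a b. Csum q (\<lambda>c d. h a c b d)))"
proof -
  have *: "Csum x (\<lambda>p q. Csum p (\<lambda>a b. Csum q (\<lambda>c d. h a b c d)))
    = Csum x (\<lambda>a p. Csum p (\<lambda>b q. Csum q (\<lambda>c d. h a b c d)))"
    if "\<And>b c d. Clin (\<lambda>a. h a b c d)" "\<And>a c d. Clin (\<lambda>b. h a b c d)"
      "\<And>a b d. Clin (\<lambda>c. h a b c d)" "\<And>a b c. Clin (\<lambda>d. h a b c d)" for h :: "'c \<Rightarrow> 'c \<Rightarrow> 'c \<Rightarrow> 'c \<Rightarrow> ('k, 'e) fsum"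
    by (rule Csum_coassoc) (intro klin_sweedler_param Clin_Csum that)+
  show ?thesis
    by (subst (1 2) *, (rule assms)+, intro sweedler_cong Csum_swap12) (rule assms)+
qed

end

lemma klin_tproj_fcons_comp:
  assumes "klin sc fscale (\<lambda>x. tproj M n (h x))"
  shows "klin sc fscale (\<lambda>x. tproj M (Suc n) (fcons v (h x)))"
  by (rule klin_tproj_factor[OF klin_tproj_comp[OF klin_fcons] _ assms])
    (use balanced_tproj[of M "Suc n"] in simp)

lemma map_head_fmult:
  fixes b :: "'u::{ring, monoid_mult}"
  assumes "p \<in> fsums (Suc n)" "q \<in> fsums (Suc n)"
  shows "fmult (map_head (\<lambda>y. b * y) p) q = map_head (\<lambda>y. b * y) (fmult p q)"
proof (rule klin_fsums_eqI[OF _ _ assms(2)])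
  fix w :: "'u list" assume w: "length w = Suc n"
  show "fmult (map_head (\<lambda>y. b * y) p) (word w) = map_head (\<lambda>y. b * y) (fmult p (word w))"
  proof (rule klin_fsums_eqI[OF _ _ assms(1)])
    fix v :: "'u list" assume v: "length v = Suc n"
    show "fmult (map_head ((*) b) (word v)) (word w) = map_head ((*) b) (fmult (word v) (word w))"
      using v w by (cases v; cases w) (simp_all add: mult.assoc)
  qed (auto intro!: klin_fbilin_left klin_fbilin_left_comp klin_map_head klin_comp[OF klin_map_head])
qed (auto intro!: klin_fbilin_right klin_comp[OF klin_map_head])

section \<open>Left bialgebroids\<close>

text \<open>Splits off one leg: (u1 \<otimes> u2 \<otimes> ...)(z \<otimes> q) = u1 z \<otimes> (u2
  \<otimes> ...) q. The projection stands inside the sum so that the integrand can be shown to be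
  balanced.\<close>

lemma tproj_fmult_iter_comult:
  "tproj M (Suc (Suc n)) (fmult (iter_comult D (Suc n) u) (fcons z q))
    = sweedler D u (\<lambda>v w. tproj M (Suc (Suc n)) (fcons (v * z) (fmult (iter_comult D n w) q)))"
  unfolding iter_comult_Suc
  by (subst klin_sweedler_comp[OF klin_tproj_comp[OF klin_fbilin_left]]) (simp add: fbilin_map2_fcons)

context left_bialgebroid
begin

abbreviation L where "L \<equiv> L_bimod H"
abbreviation \<Delta> where "\<Delta> \<equiv> comult H"
abbreviation U_lin where "U_lin \<equiv> klin (tot_scal H) fscale"

lemma L_bimod_simps [simp]:
  "scal L = tot_scal H" "lact L a u = src H a * u" "ract L u a = tgt H a * u"
  by (simp_all add: L_bimod_def)

lemma klin_mult_left: "klin (tot_scal H) (tot_scal H) (\<lambda>u. u * v)"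
  and klin_mult_right: "klin (tot_scal H) (tot_scal H) (\<lambda>u. v * u)"
  by (simp_all add: klin_def distrib_left distrib_right U.scale_mult_left U.scale_mult_right)

lemma balanced_fmult_left:
  assumes "q \<in> fsums n"
  shows "balanced L n (\<lambda>w. tproj L n (fmult (word w) q))"
  by (rule balanced_tproj_fmult_left[OF _ _ _ assms]) (use klin_mult_left in \<open>simp_all add: mult.assoc\<close>)

lemma fmult_left_cong:
  "tproj L n p = tproj L n p' \<Longrightarrow> q \<in> fsums n \<Longrightarrow> tproj L n (fmult p q) = tproj L n (fmult p' q)"
  by (rule klin_tproj_cong[OF klin_tproj_comp[OF klin_fbilin_left] balanced_fmult_left])

lemma klin_tproj_fmult_left:
  assumes "klin sc fscale (\<lambda>x. tproj L n (h x))" "q \<in> fsums n"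
  shows "klin sc fscale (\<lambda>x. tproj L n (fmult (h x) q))"
  by (rule klin_tproj_factor[OF klin_tproj_comp[OF klin_fbilin_left] balanced_fmult_left assms(1)])
    (rule assms(2))

text \<open>t(b) v z \<otimes> h(w) = v z \<otimes> s(b) h(w) = v z \<otimes> h(s(b) w), the last
  step by \<open>lact\<close>. The factor \<open>z\<close> serves products with a first letter;
  \<open>z = 1\<close> gives bare coproducts.\<close>

lemma balanced2_fcons:
  assumes h: "\<And>w. h w \<in> fsums (Suc n)" "U_lin (\<lambda>w. tproj L (Suc n) (h w))"
    and lact: "\<And>b w. tproj L (Suc n) (h (src H b * w)) = tproj L (Suc n) (map_head ((*) (src H b)) (h w))"
  shows "balanced2 L (\<lambda>v w. tproj L (Suc (Suc n)) (fcons (v * z) (h w)))"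
proof (rule balanced2I)
  fix w
  show "klin (scal L) fscale (\<lambda>v. tproj L (Suc (Suc n)) (fcons (v * z) (h w)))"
    using klin_comp[OF klin_tproj_fcons[OF h(1), of L] klin_mult_left[of z, folded L_bimod_simps]] by simp
next
  fix v
  show "klin (scal L) fscale (\<lambda>w. tproj L (Suc (Suc n)) (fcons (v * z) (h w)))"
    using h(2) by (intro klin_tproj_fcons_comp) simp
next
  fix v b w
  have "tproj L (Suc (Suc n)) (fcons (tgt H b * (v * z)) (h w))
      = tproj L (Suc (Suc n)) (fcons (v * z) (map_head ((*) (src H b)) (h w)))"
    using tproj_fcons_swap[OF h(1), of L "v * z" b w] by (simp add: L_bimod_simps(2)[abs_def])
  also have "\<dots> = tproj L (Suc (Suc n)) (fcons (v * z) (h (src H b * w)))"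
    by (rule tproj_fcons_cong[OF lact[symmetric]])
  finally show "tproj L (Suc (Suc n)) (fcons (ract L v b * z) (h w))
      = tproj L (Suc (Suc n)) (fcons (v * z) (h (lact L b w)))"
    by (simp add: mult.assoc)
qed

text \<open>The two claims need a joint induction: both, for one leg fewer, make the integrand of
  the next coproduct balanced, and only then can that coproduct be rewritten.\<close>

lemma iter_comult_klin_lact:
  "U_lin (\<lambda>u. tproj L (Suc n) (iter_comult \<Delta> n u)) \<and>
   (\<forall>b u. tproj L (Suc n) (iter_comult \<Delta> n (src H b * u))
     = tproj L (Suc n) (map_head ((*) (src H b)) (iter_comult \<Delta> n u)))"
proof (induction n)
  case 0
  show ?case using balanced_tproj[of L 1] by simp
next
  case (Suc n)
  have b: "balanced2 L (\<lambda>v w. tproj L (Suc (Suc n)) (fcons v (iter_comult \<Delta> n w)))"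
    using balanced2_fcons[of "iter_comult \<Delta> n" n 1, OF iter_comult_in_fsums] Suc by simp
  have s: "tproj L (Suc (Suc n)) (iter_comult \<Delta> (Suc n) u)
    = sweedler \<Delta> u (\<lambda>v w. tproj L (Suc (Suc n)) (fcons v (iter_comult \<Delta> n w)))" for u
    unfolding iter_comult_Suc by (rule klin_sweedler_comp[OF klin_tproj])
  have h: "map_head ((*) (src H b)) (iter_comult \<Delta> (Suc n) u)
      = sweedler \<Delta> u (\<lambda>v w. fcons (src H b * v) (iter_comult \<Delta> n w))" for b u
    unfolding iter_comult_Suc by (simp add: klin_sweedler_comp[OF klin_map_head] map_head_fcons)
  show ?case
    using klin_sweedler[OF b] sweedler_lact[OF b]
    by (auto simp: s h klin_sweedler_comp[OF klin_tproj])
qed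

lemmas klin_iter_comult = iter_comult_klin_lact[THEN conjunct1]
lemmas iter_comult_lact = iter_comult_klin_lact[THEN conjunct2, rule_format]

lemma balanced2_fmult_iter_comult:
  assumes "q \<in> fsums (Suc n)"
  shows "balanced2 L (\<lambda>v w. tproj L (Suc (Suc n)) (fcons (v * z) (fmult (iter_comult \<Delta> n w) q)))"
proof (rule balanced2_fcons)
  show "fmult (iter_comult \<Delta> n w) q \<in> fsums (Suc n)" for w
    by (intro fmult_in_fsums iter_comult_in_fsums assms)
  show "U_lin (\<lambda>w. tproj L (Suc n) (fmult (iter_comult \<Delta> n w) q))"
    by (rule klin_tproj_fmult_left[OF klin_iter_comult assms])
  show "tproj L (Suc n) (fmult (iter_comult \<Delta> n (src H b * w)) q)
    = tproj L (Suc n) (map_head ((*) (src H b)) (fmult (iter_comult \<Delta> n w) q))" for b w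
    using fmult_left_cong[OF iter_comult_lact assms]
    by (simp add: map_head_fmult[OF iter_comult_in_fsums assms])
qed

lemma balanced2_iter_comult:
  "balanced2 L (\<lambda>v w. tproj L (Suc (Suc n)) (fcons v (iter_comult \<Delta> n w)))"
  using balanced2_fcons[of "iter_comult \<Delta> n" n 1, OF iter_comult_in_fsums klin_iter_comult iter_comult_lact]
  by simp

lemma sweedler_takeuchi:
  assumes "balanced2 L g"
  shows "sweedler \<Delta> u (\<lambda>v w. g (v * tgt H a) w) = sweedler \<Delta> u (\<lambda>v w. g v (w * src H a))"
proof -
  let ?p = "trep (\<Delta> u)"
  have p: "?p \<in> \<Delta> u" by (rule trep_in[OF comult_closed])
  have "tclass L 2 (flin (\<lambda>w. word [w ! 0 * tgt H a, w ! 1]) ?p)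
      = tclass L 2 (flin (\<lambda>w. word [w ! 0, w ! 1 * src H a]) ?p)"
    using comult_takeuchi[of u] p by (auto simp: takeuchi_product_def)
  moreover have "flin (\<lambda>w. word [w ! 0 * tgt H a, w ! 1]) ?p \<in> fsums 2"
    by (rule flin_in_fsums) simp
  ultimately have "tproj L 2 (flin (\<lambda>w. word [w ! 0 * tgt H a, w ! 1]) ?p)
      = tproj L 2 (flin (\<lambda>w. word [w ! 0, w ! 1 * src H a]) ?p)"
    by (rule tclass_eqD)
  from flin_tproj_eq[OF balanced2_balanced[OF assms] this] show ?thesis
    by (simp add: flin_flin sweedler_def)
qed

text \<open>Since \<Delta> is a bimodule map with \<Delta>(1) = 1 \<otimes> 1, it sends s(a) to s(a)
  \<otimes> 1 and t(a) to 1 \<otimes> t(a); multiplicativity does the rest.\<close>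

lemma
  assumes g: "balanced2 L g"
  shows sweedler_mult_src: "sweedler \<Delta> (u * src H a) g = sweedler \<Delta> u (\<lambda>v w. g (v * src H a) w)"
    and sweedler_mult_tgt: "sweedler \<Delta> (u * tgt H a) g = sweedler \<Delta> u (\<lambda>v w. g v (w * tgt H a))"
proof -
  \<comment> \<open>\<open>K\<close> freezes the coproduct of \<open>u\<close> and leaves that of
    the right factor variable. The Takeuchi condition on \<open>u\<close> makes it balanced, so the
    rules for \<Delta> apply to the right factor alone.\<close>
  define K where "K x y = sweedler \<Delta> u (\<lambda>v w. g (v * x) (w * y))" for x y
  have g1: "U_lin (\<lambda>v. g (v * x) y)" "U_lin (\<lambda>v. g (w * v) y)"
       "U_lin (\<lambda>v. g y (v * x))" "U_lin (\<lambda>v. g y (w * v))" for w x y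
    using g by (auto simp: balanced2_def
        intro: klin_comp[of "tot_scal H" _ "\<lambda>v. g v y" for y, OF _ klin_mult_left]
        klin_comp[of "tot_scal H" _ "\<lambda>v. g v y" for y, OF _ klin_mult_right]
        klin_comp[of "tot_scal H" _ "g y" for y, OF _ klin_mult_left]
        klin_comp[of "tot_scal H" _ "g y" for y, OF _ klin_mult_right])
  have gxy: "balanced2 L (\<lambda>v w. g (v * x) (w * y))" for x y
    using g1 g by (auto simp: balanced2_def mult.assoc)
  have K: "balanced2 L K"
  proof (rule balanced2I)
    fix x y b
    show "K (ract L x b) y = K x (lact L b y)"
      using sweedler_takeuchi[OF gxy, of u b x y] by (simp add: K_def mult.assoc)
  qed (auto simp: K_def[abs_def] intro!: klin_sweedler_param g1)
  have mult: "sweedler \<Delta> (u * y) g = sweedler \<Delta> y K" for y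
    unfolding sweedler_tclass[OF g comult_mult] K_def
    by (subst sweedler_swap, unfold sweedler_def fbilin_def flin_flin flin_word_arg,
        (rule flin_fsums_cong[OF trep_comult_in_fsums])+) (simp add: numeral_2_eq_2)
  have KL: "U_lin (\<lambda>v. K (b * v) y)" "U_lin (\<lambda>v. K y (b * v))"  "U_lin (\<lambda>v. K v y)" "U_lin (\<lambda>v. K y v)" for b y
    using K by (auto simp: balanced2_def
        intro: klin_comp[of "tot_scal H" _ "\<lambda>v. K v y" for y, OF _ klin_mult_right]
        klin_comp[of "tot_scal H" _ "K y" for y, OF _ klin_mult_right])
  have Kb: "K (tgt H b * v) w = K v (src H b * w)" for b v w
    using K by (simp add: balanced2_def)
  have Ks: "balanced2 L (\<lambda>v w. K (src H a * v) w)"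
  proof (rule balanced2I)
    fix v b w
    show "K (src H a * ract L v b) w = K (src H a * v) (lact L b w)"
      using Kb[of b "src H a * v" w] by (simp add: mult.assoc[symmetric] src_tgt_commute)
  qed (use KL in auto)
  have Kt: "balanced2 L (\<lambda>v w. K v (tgt H a * w))"
  proof (rule balanced2I)
    fix v b w
    show "K (ract L v b) (tgt H a * w) = K v (tgt H a * lact L b w)"
      using Kb[of b v "tgt H a * w"] by (simp add: mult.assoc[symmetric] src_tgt_commute)
  qed (use KL in auto)
  have "sweedler \<Delta> (src H a) K = sweedler \<Delta> 1 (\<lambda>v w. K (src H a * v) w)"
    using sweedler_lact[OF K, of a 1] by simp
  also have "\<dots> = K (src H a) 1"
    by (simp add: sweedler_tclass[OF Ks comult_one])
  finally show "sweedler \<Delta> (u * src H a) g = sweedler \<Delta> u (\<lambda>v w. g (v * src H a) w)"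
    by (simp add: mult K_def)
  have "sweedler \<Delta> (tgt H a) K = sweedler \<Delta> 1 (\<lambda>v w. K v (tgt H a * w))"
    using sweedler_ract[OF K, of 1 a] by simp
  also have "\<dots> = K 1 (tgt H a)"
    by (simp add: sweedler_tclass[OF Kt comult_one])
  finally show "sweedler \<Delta> (u * tgt H a) g = sweedler \<Delta> u (\<lambda>v w. g v (w * tgt H a))"
    by (simp add: mult K_def)
qed

lemma fmult_iter_comult_src:
  assumes "q \<in> fsums n"
  shows "tproj L (Suc n) (fmult (iter_comult \<Delta> n (u * src H a)) (fcons z q))
    = tproj L (Suc n) (fmult (iter_comult \<Delta> n u) (fcons (src H a * z) q))"
proof (cases n)
  case 0
  show ?thesis
    by (rule klin_fsums_eqI[OF _ _ assms])
      (auto simp: 0 mult.assoc intro!: klin_tproj_comp klin_fbilin_right_comp klin_fcons)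
next
  case (Suc m)
  with assms have q: "q \<in> fsums (Suc m)" by simp
  show ?thesis
    unfolding Suc tproj_fmult_iter_comult sweedler_mult_src[OF balanced2_fmult_iter_comult[OF q]]
    by (simp add: mult.assoc)
qed

text \<open>At each splitting t(a) moves to the right of the second leg, hence ends at the very last
  one, where associativity hands it to the last letter of \<open>w\<close>.\<close>

lemma fmult_iter_comult_tgt:
  assumes "length w = Suc n"
  shows "tproj L (Suc n) (fmult (iter_comult \<Delta> n (u * tgt H a)) (word w))
    = tproj L (Suc n) (fmult (iter_comult \<Delta> n u) (map_last ((*) (tgt H a)) (word w)))"
  using assms
proof (induction n arbitrary: u w)
  case 0
  then obtain z where "w = [z]" by (cases w) auto
  then show ?case by (simp add: mult.assoc)
next
  case (Suc n)
  then obtain z zs where w: "w = z # zs" "length zs = Suc n" by (cases w) auto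
  have zs: "word zs \<in> fsums (Suc n)" using w by simp
  have "tproj L (Suc (Suc n)) (fmult (iter_comult \<Delta> (Suc n) (u * tgt H a)) (word w))
    = sweedler \<Delta> u (\<lambda>x y. tproj L (Suc (Suc n)) (fcons (x * z) (fmult (iter_comult \<Delta> n (y * tgt H a)) (word zs))))"
    unfolding w fcons_word[symmetric] tproj_fmult_iter_comult
      sweedler_mult_tgt[OF balanced2_fmult_iter_comult[OF zs]] ..
  also have "\<dots> = sweedler \<Delta> u (\<lambda>x y. tproj L (Suc (Suc n)) (fcons (x * z)
      (fmult (iter_comult \<Delta> n y) (map_last ((*) (tgt H a)) (word zs)))))"
    by (intro sweedler_cong tproj_fcons_cong Suc.IH w)
  also have "\<dots> = tproj L (Suc (Suc n)) (fmult (iter_comult \<Delta> (Suc n) u) (fcons z (map_last ((*) (tgt H a)) (word zs))))"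
    unfolding tproj_fmult_iter_comult ..
  also have "fcons z (map_last ((*) (tgt H a)) (word zs)) = map_last ((*) (tgt H a)) (word w)"
    using w by auto
  finally show ?case .
qed

lemma iter_comult_ract:
  "tproj L (Suc n) (iter_comult \<Delta> n (tgt H a * u)) = tproj L (Suc n) (map_last ((*) (tgt H a)) (iter_comult \<Delta> n u))"
proof (induction n arbitrary: u)
  case 0
  show ?case by simp
next
  case (Suc n)
  have "tproj L (Suc (Suc n)) (iter_comult \<Delta> (Suc n) (tgt H a * u))
      = sweedler \<Delta> u (\<lambda>v w. tproj L (Suc (Suc n)) (fcons v (iter_comult \<Delta> n (tgt H a * w))))"
    using sweedler_ract[OF balanced2_iter_comult[of n], of u a]
    unfolding iter_comult_Suc by (simp add: klin_sweedler_comp[OF klin_tproj])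
  also have "\<dots> = sweedler \<Delta> u (\<lambda>v w. tproj L (Suc (Suc n)) (fcons v (map_last ((*) (tgt H a)) (iter_comult \<Delta> n w))))"
    by (intro sweedler_cong tproj_fcons_cong Suc.IH)
  also have "\<dots> = tproj L (Suc (Suc n)) (map_last ((*) (tgt H a)) (iter_comult \<Delta> (Suc n) u))"
    unfolding iter_comult_Suc
    by (simp add: klin_sweedler_comp[OF klin_tproj] klin_sweedler_comp[OF klin_map_last]
        map_last_fcons[OF iter_comult_in_fsums])
  finally show ?case .
qed

text \<open>
  The iterated coproduct lies in the \<open>n\<close>-fold Takeuchi product; this is what makes left
  multiplication by it well defined.
\<close>

lemma balanced_fmult_iter_comult:
  "balanced L (Suc n) (\<lambda>z. tproj L (Suc n) (fmult (iter_comult \<Delta> n u) (word z)))"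
proof (induction n arbitrary: u)
  case 0
  show ?case
    using klin_comp[OF klin_tproj_fcons[of "word []" 0 L] klin_mult_right[of u, folded L_bimod_simps]]
    by simp
next
  case (Suc n)
  let ?G = "\<lambda>z. tproj L (Suc (Suc n)) (fmult (iter_comult \<Delta> (Suc n) u) (word z))"
  have G: "?G (z # zs) = sweedler \<Delta> u (\<lambda>v w. tproj L (Suc (Suc n)) (fcons (v * z) (fmult (iter_comult \<Delta> n w) (word zs))))"
    for z zs
    unfolding fcons_word[symmetric] tproj_fmult_iter_comult ..
  have "klin (scal L) fscale (\<lambda>z. ?G (z # zs))" if zs: "length zs = Suc n" for zs
  proof -
    have f: "fmult (iter_comult \<Delta> n w) (word zs) \<in> fsums (Suc n)" for w
      using zs by (intro fmult_in_fsums iter_comult_in_fsums) simp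
    show ?thesis
      unfolding G L_bimod_simps
      by (intro klin_sweedler_param klin_comp[OF klin_tproj_fcons[OF f, of L, unfolded L_bimod_simps] klin_mult_right])
  qed
  moreover have "?G (ract L z a # y # ys) = ?G (z # lact L a y # ys)" if ys: "Suc (length ys) = Suc n" for z a y ys
  proof -
    let ?g = "\<lambda>v w. tproj L (Suc (Suc n)) (fcons (v * z) (fmult (iter_comult \<Delta> n w) (word (y # ys))))"
    have "balanced2 L ?g" by (rule balanced2_fmult_iter_comult) (use ys in simp)
    \<comment> \<open>The Takeuchi condition trades t(a) on the right of the first leg for s(a) on
      the right of the second; \<open>fmult_iter_comult_src\<close> then passes s(a) on to the
      letter \<open>y\<close>.\<close>
    from sweedler_takeuchi[OF this, of u a]
    have "?G (tgt H a * z # y # ys) = sweedler \<Delta> u (\<lambda>v w. ?g v (w * src H a))"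
      unfolding G by (simp add: mult.assoc)
    also have "\<dots> = ?G (z # src H a * y # ys)"
      unfolding G fcons_word[symmetric, of _ ys]
      by (intro sweedler_cong tproj_fcons_cong fmult_iter_comult_src) (use ys in simp)
    finally show ?thesis by simp
  qed
  moreover have "balanced L (Suc n) (\<lambda>zs. ?G (z # zs))" for z
    unfolding G
    by (intro balanced_sweedler balanced_tproj_factor[OF klin_tproj_comp[OF klin_fcons] _ Suc.IH])
      (use balanced_tproj[of L "Suc (Suc n)"] in simp)
  ultimately show ?case unfolding balanced.simps(2)[of L "Suc n"] by blast
qed

lemma fmult_iter_comult_cong:
  assumes "tproj L (Suc n) q = tproj L (Suc n) q'"
  shows "tproj L (Suc n) (fmult (iter_comult \<Delta> n u) q) = tproj L (Suc n) (fmult (iter_comult \<Delta> n u) q')"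
  by (rule klin_tproj_cong[OF klin_tproj_comp[OF klin_fbilin_right] balanced_fmult_iter_comult assms])

end

section \<open>Measurings and the Hopf-Galois map\<close>

lemma balanced_k_bimod:
  "balanced M n G \<Longrightarrow> balanced (k_bimod (scal M)) n G"
proof (induction n arbitrary: G)
  case (Suc n)
  have "G (scal M a u # v # ys) = G (u # scal M a v # ys)" if "Suc (length ys) = n" for a u v ys
    using balanced_klin[OF Suc.prems, of "[]" "v # ys"] balanced_klin[OF Suc.prems, of "[u]" ys] that
    by (simp add: klin_scale[of "scal M" fscale "\<lambda>u. G (u # _)"] klin_scale[of "scal M" fscale "\<lambda>v. G (u # v # _)"])
  then show ?case
    using Suc by (simp add: k_bimod_def)
qed simp

text \<open>The tensor power over the base algebra is a quotient of the one over the field, so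
  identities proved over the field descend.\<close>

lemma tproj_k_bimod_cong:
  "tproj (k_bimod (scal M)) n p = tproj (k_bimod (scal M)) n q \<Longrightarrow> tproj M n p = tproj M n q"
  by (rule klin_tproj_cong[OF klin_tproj balanced_k_bimod[OF balanced_tproj]])

context left_bialgebroid
begin

lemma fmult_iter_comult_tgt_fsums:
  assumes "q \<in> fsums (Suc n)"
  shows "tproj L (Suc n) (fmult (iter_comult \<Delta> n (u * tgt H a)) q)
    = tproj L (Suc n) (fmult (iter_comult \<Delta> n u) (map_last ((*) (tgt H a)) q))"
  by (rule klin_fsums_eqI[OF _ _ assms])
    (auto intro!: klin_tproj_comp klin_fbilin_right klin_fbilin_right_comp klin_map_last fmult_iter_comult_tgt
      simp del: map_last_word)

text \<open>Both u t(a) \<otimes> v and u \<otimes> t(a) v put t(a) on the left of the last slot of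
  the factor that \<Delta>(u) multiplies: the former because t(a) travels to the last leg of the
  coproduct of u t(a), the latter because it does so in the coproduct of t(a) v.\<close>

lemma balanced_xi_word: "balanced (R_bimod H) n (\<lambda>us. tproj L n (xi_word \<Delta> us))"
proof (induction n)
  case (Suc n)
  have "klin (scal (R_bimod H)) fscale (\<lambda>u. tproj L (Suc n) (xi_word \<Delta> (u # ys)))" if "length ys = n" for ys
  proof -
    have "fcons 1 (xi_word \<Delta> ys) \<in> fsums (Suc n)"
      using xi_word_in_fsums[of \<Delta> ys] that by auto
    then show ?thesis
      using klin_tproj_fmult_left[OF klin_iter_comult, of "fcons 1 (xi_word \<Delta> ys)" n] that
      by (simp add: R_bimod_def xi_word_Cons)
  qed
  moreover have "tproj L (Suc n) (xi_word \<Delta> (u * tgt H a # v # ys))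
      = tproj L (Suc n) (xi_word \<Delta> (u # tgt H a * v # ys))" if "Suc (length ys) = n" for u a v ys
  proof -
    obtain m where m: "n = Suc m" "length ys = m" using \<open>Suc (length ys) = n\<close> by auto
    let ?q = "fcons 1 (xi_word \<Delta> ys)" and ?t = "(*) (tgt H a)"
    have q: "?q \<in> fsums (Suc m)"
      using xi_word_in_fsums[of \<Delta> ys] m by auto
    have q': "fmult (iter_comult \<Delta> m v) ?q \<in> fsums (Suc m)"
      by (intro fmult_in_fsums iter_comult_in_fsums q)
    have "tproj L (Suc n) (xi_word \<Delta> (u * tgt H a # v # ys))
      = tproj L (Suc (Suc m)) (fmult (iter_comult \<Delta> (Suc m) u)
          (map_last ?t (fcons 1 (fmult (iter_comult \<Delta> m v) ?q))))"
      using fcons_in_fsums[OF q', of 1] by (simp add: xi_word_Cons m fmult_iter_comult_tgt_fsums)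
    also have "\<dots> = tproj L (Suc (Suc m)) (fmult (iter_comult \<Delta> (Suc m) u)
          (fcons 1 (fmult (map_last ?t (iter_comult \<Delta> m v)) ?q)))"
      by (simp add: map_last_fcons[OF q'] map_last_fmult[OF iter_comult_in_fsums q])
    \<comment> \<open>The change takes place inside the right factor of a product with the coproduct
      of \<open>u\<close>, which is where the Takeuchi condition is needed.\<close>
    also have "\<dots> = tproj L (Suc (Suc m)) (fmult (iter_comult \<Delta> (Suc m) u)
          (fcons 1 (fmult (iter_comult \<Delta> m (tgt H a * v)) ?q)))"
      by (intro fmult_iter_comult_cong tproj_fcons_cong fmult_left_cong iter_comult_ract[symmetric] q)
    finally show ?thesis
      by (simp add: xi_word_Cons m)
  qed
  moreover have "balanced (R_bimod H) n (\<lambda>us. tproj L (Suc n) (xi_word \<Delta> (u # us)))" for u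
  proof -
    have "balanced L n (\<lambda>w. tproj L (Suc n) (fmult (iter_comult \<Delta> n u) (fcons 1 (word w))))"
      using balanced_fmult_iter_comult[of n u] by simp
    then have "balanced (R_bimod H) n (\<lambda>us. tproj L (Suc n) (fmult (iter_comult \<Delta> n u) (fcons 1 (xi_word \<Delta> us))))"
      by (intro balanced_tproj_factor[OF _ _ Suc.IH]) (intro klin_tproj_comp klin_fbilin_right_comp klin_fcons)
    then show ?thesis
      by (subst balanced_cong) (auto simp: xi_word_Cons)
  qed
  ultimately show ?case by (simp add: R_bimod_def)
qed simp

lemma flin_xi_word_cong:
  "tproj (R_bimod H) n p = tproj (R_bimod H) n q \<Longrightarrow>
    tproj L n (flin (xi_word \<Delta>) p) = tproj L n (flin (xi_word \<Delta>) q)"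
  unfolding tproj_flin_eq_flin_tproj by (rule flin_tproj_eq[OF balanced_xi_word])

end

text \<open>\<open>meas n x\<close> acts on words of length \<open>n + 1\<close>.\<close>

locale cocommutative_measuring =
  cocommutative_coalgebra C + algebra_measuring C sc sc' m + target: k_algebra sc'
  for C :: "('k::field, 'c::ab_group_add) coalgebra_data"
    and sc :: "'k \<Rightarrow> 'u::{ring, monoid_mult} \<Rightarrow> 'u"
    and sc' :: "'k \<Rightarrow> 'v::{ring, monoid_mult} \<Rightarrow> 'v"
    and m :: "'c \<Rightarrow> 'u \<Rightarrow> 'v"
begin

definition meas :: "nat \<Rightarrow> 'c \<Rightarrow> ('k, 'u) fsum \<Rightarrow> ('k, 'v) fsum" where
  "meas n x p = fbilin (map2 m) (iter_comult (ccomult C) n x) p"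

abbreviation K where "K \<equiv> k_bimod sc'"

lemma klin_meas: "klin fscale fscale (meas n x)"
  unfolding meas_def by (rule klin_fbilin_right)

lemma klin_meas_comp: "klin scl fscale h \<Longrightarrow> klin scl fscale (\<lambda>y. meas n x (h y))"
  by (rule klin_comp[OF klin_meas])

lemma meas_0 [simp]: "meas 0 x (word [u]) = word [m x u]"
  by (simp add: meas_def)

lemma meas_fcons: "meas (Suc n) x (fcons u p) = Csum x (\<lambda>y z. fcons (m y u) (meas n z p))"
  unfolding meas_def iter_comult_Suc
  by (simp add: klin_sweedler_comp[OF klin_fbilin_left] fbilin_map2_fcons)

lemma tproj_meas_fcons:
  "tproj M l (meas (Suc n) x (fcons u p)) = Csum x (\<lambda>y z. tproj M l (fcons (m y u) (meas n z p)))"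
  by (simp add: meas_fcons klin_sweedler_comp[OF klin_tproj])

lemma meas_in_fsums: "p \<in> fsums (Suc n) \<Longrightarrow> meas n x p \<in> fsums (Suc n)"
  unfolding meas_def by (rule fbilin_in_fsums[OF iter_comult_in_fsums]) auto

lemma klin_measuring: "klin sc sc' (m x)"
  by (rule klin_linear[OF measuring_linear])

lemma klin_measuring_left: "klin (cscal C) sc' (\<lambda>x. m x u)"
  by (simp add: klin_def measuring_add measuring_scale)

lemma klin_mult_left: "klin sc' sc' (\<lambda>u. u * v)"
  and klin_mult_right: "klin sc' sc' (\<lambda>u. v * u)"
  by (simp_all add: klin_def distrib_left distrib_right target.scale_mult_left target.scale_mult_right)

lemma klin_measuring_mult: "klin sc' fscale f \<Longrightarrow> f (m x (a * b)) = Csum x (\<lambda>y z. f (m y a * m z b))"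
  unfolding measuring_mult sweedler_def by (rule klin_lin_ext)

text \<open>Because of \<open>trep\<close>, \<open>meas n x p\<close> is linear in \<open>x\<close>
  only modulo the relations. \<open>M\<close> is left open so that the result serves both the field
  and the base algebra.\<close>

lemma Clin_tproj_meas:
  assumes M: "scal M = sc'" and p: "p \<in> fsums (Suc n)"
  shows "Clin (\<lambda>x. tproj M (Suc n) (meas n x p))"
proof -
  have w: "Clin (\<lambda>x. tproj M (Suc n) (meas n x (word w)))" if "length w = Suc n" for w
    using that
  proof (induction n arbitrary: w)
    case 0
    then obtain u where "w = [u]" by (cases w) auto
    then show ?case
      using klin_comp[OF balanced_klin[OF balanced_tproj[of M 1], of "[]" "[]", unfolded M] klin_measuring_left]
      by simp
  next
    case (Suc n)
    then obtain u us where w: "w = u # us" "length us = Suc n" by (cases w) auto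
    have us: "meas n y (word us) \<in> fsums (Suc n)" for y
      by (rule meas_in_fsums) (simp add: w)
    show ?case
      unfolding w fcons_word[symmetric] tproj_meas_fcons
      by (intro Clin_Csum klin_comp[OF klin_tproj_fcons[OF us, of M, unfolded M] klin_measuring_left]
          klin_tproj_fcons_comp Suc.IH w)
  qed
  have "tproj M (Suc n) (meas n x p) = flin (\<lambda>w. tproj M (Suc n) (meas n x (word w))) p" for x
    by (rule klin_eq_flin[OF klin_tproj_comp[OF klin_meas]])
  then show ?thesis
    using p w by (auto simp: fsums_def intro!: klin_flin_param_keys)
qed

lemma Clin_tproj_fmult_left:
  assumes "q \<in> fsums n" "Clin (\<lambda>x. tproj K n (h x))"
  shows "Clin (\<lambda>x. tproj K n (fmult (h x) q))"
  by (rule klin_tproj_factor[OF klin_tproj_comp[OF klin_fbilin_left] balanced_tproj_fmult_left assms(2)])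
    (use klin_mult_left in \<open>auto simp: k_bimod_def target.scale_mult_left assms\<close>)

lemma Clin_tproj_fmult_right:
  assumes "p \<in> fsums n" "Clin (\<lambda>x. tproj K n (h x))"
  shows "Clin (\<lambda>x. tproj K n (fmult p (h x)))"
  by (rule klin_tproj_factor[OF klin_tproj_comp[OF klin_fbilin_right] balanced_tproj_fmult_right assms(2)])
    (use klin_mult_right in \<open>auto simp: k_bimod_def target.scale_mult_right assms\<close>)

lemma scal_K: "scal K = sc'"
  by (simp add: k_bimod_def)

text \<open>The induction needs the product of the tails to depend linearly, modulo the relations,
  on the legs in both factors. Over the field \<open>fmult\<close> respects the relations in each
  factor; over the base algebra it in general fails to do so in the right one.\<close>

lemma tproj_meas_fmult_word:
  assumes "length v = Suc n" "length w = Suc n"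
  shows "tproj K (Suc n) (meas n x (fmult (word v) (word w)))
    = tproj K (Suc n) (Csum x (\<lambda>y z. fmult (meas n y (word v)) (meas n z (word w))))"
  using assms
proof (induction n arbitrary: v w x)
  case 0
  then obtain a b where "v = [a]" "w = [b]" by (cases v; cases w) auto
  then show ?case
    using klin_measuring_mult[OF balanced_klin[OF balanced_tproj[of K 1], of "[]" "[]", unfolded scal_K], of x a b]
    by (simp add: klin_sweedler_comp[OF klin_tproj])
next
  case (Suc n)
  obtain a v' where v: "v = a # v'" "length v' = Suc n" using Suc.prems(1) by (cases v) auto
  obtain b w' where w: "w = b # w'" "length w' = Suc n" using Suc.prems(2) by (cases w) auto
  define h where "h y1 y2 z1 z2 = tproj K (Suc (Suc n)) (fcons (m y1 a * m y2 b)
      (fmult (meas n z1 (word v')) (meas n z2 (word w'))))" for y1 y2 z1 z2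
  have f: "meas n z (word v') \<in> fsums (Suc n)" "meas n z (word w') \<in> fsums (Suc n)" for z
    by (simp_all add: meas_in_fsums v w)
  have g: "Clin (\<lambda>z. tproj K (Suc n) (meas n z (word v')))" "Clin (\<lambda>z. tproj K (Suc n) (meas n z (word w')))"
    by (auto intro: Clin_tproj_meas simp: scal_K v w)
  have head: "klin sc' fscale (\<lambda>u. tproj K (Suc (Suc n)) (fcons u p))" if "p \<in> fsums (Suc n)" for p
    using klin_tproj_fcons[OF that, of K] by (simp add: scal_K)
  have lin: "Clin (\<lambda>y1. h y1 y2 z1 z2)" "Clin (\<lambda>y2. h y1 y2 z1 z2)"
      "Clin (\<lambda>z1. h y1 y2 z1 z2)" "Clin (\<lambda>z2. h y1 y2 z1 z2)" for y1 y2 z1 z2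
    unfolding h_def
    by (intro klin_comp[OF head] klin_comp[OF klin_mult_left] klin_comp[OF klin_mult_right] klin_measuring_left
        fmult_in_fsums f klin_tproj_fcons_comp Clin_tproj_fmult_left Clin_tproj_fmult_right g)+
  have "tproj K (Suc (Suc n)) (meas (Suc n) x (fmult (word v) (word w)))
    = Csum x (\<lambda>y z. tproj K (Suc (Suc n)) (fcons (m y (a * b)) (meas n z (fmult (word v') (word w')))))"
    unfolding v w fcons_word[symmetric] fbilin_map2_fcons tproj_meas_fcons ..
  also have "\<dots> = Csum x (\<lambda>y z. tproj K (Suc (Suc n)) (fcons (m y (a * b))
      (Csum z (\<lambda>z1 z2. fmult (meas n z1 (word v')) (meas n z2 (word w'))))))"
    by (intro sweedler_cong tproj_fcons_cong Suc.IH v w)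
  also have "\<dots> = Csum x (\<lambda>y z. Csum y (\<lambda>y1 y2. Csum z (\<lambda>z1 z2. h y1 y2 z1 z2)))"
    unfolding h_def klin_sweedler_comp[OF klin_tproj_comp[OF klin_fcons], symmetric]
    by (intro sweedler_cong klin_measuring_mult head sweedler_in_fsums fmult_in_fsums f)
  \<comment> \<open>So far \<open>y\<close> serves the two heads and \<open>z\<close> the two tails;
    after the exchange \<open>y\<close> measures all of \<open>v\<close> and \<open>z\<close> all of
    \<open>w\<close>.\<close>
  also have "\<dots> = Csum x (\<lambda>y z. Csum y (\<lambda>y1 z1. Csum z (\<lambda>y2 z2. h y1 y2 z1 z2)))"
    by (rule Csum_interchange) (rule lin)+
  also have "\<dots> = tproj K (Suc (Suc n)) (Csum x (\<lambda>y z. fmult (meas (Suc n) y (word v)) (meas (Suc n) z (word w))))"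
    unfolding v w fcons_word[symmetric] meas_fcons h_def klin_sweedler_comp[OF klin_fbilin_left]
    by (simp add: klin_sweedler_comp[OF klin_tproj] klin_sweedler_comp[OF klin_fbilin_right] fbilin_map2_fcons)
  finally show ?case .
qed

lemma tproj_meas_fmult:
  assumes M: "scal M = sc'" and p: "p \<in> fsums (Suc n)" and q: "q \<in> fsums (Suc n)"
  shows "tproj M (Suc n) (meas n x (fmult p q))
    = Csum x (\<lambda>y z. tproj M (Suc n) (fmult (meas n y p) (meas n z q)))"
proof -
  have w: "tproj M (Suc n) (meas n x (fmult (word v) (word w)))
    = Csum x (\<lambda>y z. tproj M (Suc n) (fmult (meas n y (word v)) (meas n z (word w))))"
    if "length v = Suc n" "length w = Suc n" for v w
    using tproj_k_bimod_cong[of M, unfolded M, OF tproj_meas_fmult_word[OF that]]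
    by (simp add: klin_sweedler_comp[OF klin_tproj])
  show ?thesis
  proof (rule klin_fsums_eqI[OF _ _ p])
    fix v :: "'u list" assume v: "length v = Suc n"
    show "tproj M (Suc n) (meas n x (fmult (word v) q))
      = Csum x (\<lambda>y z. tproj M (Suc n) (fmult (meas n y (word v)) (meas n z q)))"
      by (rule klin_fsums_eqI[OF _ _ q])
        ((intro klin_tproj_comp klin_meas_comp klin_fbilin_right klin_fbilin_right_comp klin_meas klin_sweedler_param)+,
          erule w[OF v])
  qed (intro klin_tproj_comp klin_meas_comp klin_fbilin_left klin_fbilin_left_comp klin_meas klin_sweedler_param)+
qed

lemma tproj_meas_fcons_one:
  assumes M: "scal M = sc'" and q: "q \<in> fsums (Suc n)"
  shows "tproj M (Suc (Suc n)) (meas (Suc n) x (fcons 1 q)) = tproj M (Suc (Suc n)) (fcons 1 (meas n x q))"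
proof -
  have "tproj M (Suc (Suc n)) (meas (Suc n) x (fcons 1 q))
    = Csum x (\<lambda>y z. fscale (ccounit C y) (tproj M (Suc (Suc n)) (fcons 1 (meas n z q))))"
    unfolding tproj_meas_fcons measuring_one
    using klin_scale[OF klin_tproj_fcons[OF meas_in_fsums[OF q], of M, unfolded M]] by simp
  also have "\<dots> = tproj M (Suc (Suc n)) (fcons 1 (meas n x q))"
    by (rule Csum_counit) (intro klin_tproj_fcons_comp Clin_tproj_meas M q)
  finally show ?thesis .
qed

end

section \<open>Measurings between left bialgebroids\<close>

locale bialgebroid_measuring =
  H: left_bialgebroid H + H': left_bialgebroid H' +
  cocommutative_measuring C "tot_scal H" "tot_scal H'" \<Psi>
  for C :: "('k::field, 'c::ab_group_add) coalgebra_data"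
    and H :: "('k, 'u::{ring, monoid_mult}, 'a::{ring, monoid_mult}, 'y) bialgebroid_data_scheme"
    and H' :: "('k, 'v::{ring, monoid_mult}, 'b::{ring, monoid_mult}, 'z) bialgebroid_data_scheme"
    and \<Psi> :: "'c \<Rightarrow> 'u \<Rightarrow> 'v"
    and \<psi> :: "'c \<Rightarrow> 'a \<Rightarrow> 'b" +
  assumes measuring_src: "\<Psi> x (src H a) = src H' (\<psi> x a)"
    and measuring_tgt: "\<Psi> x (tgt H a) = tgt H' (\<psi> x a)"
    and comult_measuring:
      "comult H' (\<Psi> x u)
       = tclass (L_bimod H') 2 (fbilin (map2 \<Psi>) (trep (ccomult C x)) (trep (comult H u)))"
begin

lemma klin_tproj_fcons':
  "p \<in> fsums n \<Longrightarrow> klin (tot_scal H') fscale (\<lambda>v. tproj H'.L (Suc n) (fcons v p))"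
  using klin_tproj_fcons[of p n H'.L] by simp

text \<open>The leg acting on s(a) v splits into one for s(a) and one for v; coassociativity
  regroups the latter with the legs acting on \<open>ys\<close>.\<close>

lemma tproj_meas_lact:
  assumes ys: "length ys = n"
  shows "tproj H'.L (Suc n) (meas n x (word (src H a * v # ys)))
    = Csum x (\<lambda>y z. tproj H'.L (Suc n) (map_head ((*) (\<Psi> y (src H a))) (meas n z (word (v # ys)))))"
proof (cases n)
  case 0
  then show ?thesis
    using klin_measuring_mult[OF klin_tproj_fcons', of "word []" 0 x "src H a" v] ys by simp
next
  case (Suc k)
  have f: "meas k z (word ys) \<in> fsums (Suc k)" for z
    by (rule meas_in_fsums) (use ys Suc in simp)
  define h where "h y z w = tproj H'.L (Suc (Suc k)) (fcons (\<Psi> y (src H a) * \<Psi> z v) (meas k w (word ys)))"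
    for y z w
  have lin: "Clin (\<lambda>y. h y z w)" "Clin (\<lambda>z. h y z w)" "Clin (\<lambda>w. h y z w)" for y z w
    unfolding h_def
    by (intro klin_comp[OF klin_tproj_fcons'[OF f]] klin_comp[OF klin_mult_left] klin_comp[OF klin_mult_right]
        klin_measuring_left klin_tproj_fcons_comp Clin_tproj_meas; use ys Suc in simp)+
  have "tproj H'.L (Suc n) (meas n x (word (src H a * v # ys))) = Csum x (\<lambda>p w. Csum p (\<lambda>y z. h y z w))"
    unfolding Suc fcons_word[symmetric] tproj_meas_fcons h_def
    by (intro sweedler_cong klin_measuring_mult klin_tproj_fcons' f)
  also have "\<dots> = Csum x (\<lambda>y p. Csum p (\<lambda>z w. h y z w))"
    by (rule Csum_coassoc) (rule lin)+
  also have "\<dots> = Csum x (\<lambda>y z. tproj H'.L (Suc n) (map_head ((*) (\<Psi> y (src H a))) (meas n z (word (v # ys)))))"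
    unfolding Suc fcons_word[symmetric] meas_fcons h_def
    by (simp add: klin_sweedler_comp[OF klin_map_head] klin_sweedler_comp[OF klin_tproj] map_head_fcons)
  finally show ?thesis .
qed

text \<open>The leg acting on t(a) yields t'(\<psi>(a)), which crosses the tensor sign as
  s'(\<psi>(a)), the value of the same leg on s(a); \<open>tproj_meas_lact\<close> reunites it with
  the legs acting on the remaining letters.\<close>

lemma balanced_tproj_meas: "balanced H.L (Suc n) (\<lambda>w. tproj H'.L (Suc n) (meas n x (word w)))"
proof (induction n arbitrary: x)
  case 0
  show ?case
    using klin_comp[OF klin_tproj_fcons'[of "word []" 0] klin_measuring] by simp
next
  case (Suc n)
  let ?G = "\<lambda>w. tproj H'.L (Suc (Suc n)) (meas (Suc n) x (word w))"
  have f: "length ys = Suc n \<Longrightarrow> meas n z (word ys) \<in> fsums (Suc n)" for z ys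
    by (rule meas_in_fsums) simp
  have "klin (scal H.L) fscale (\<lambda>u. ?G (u # ys))" if "length ys = Suc n" for ys
    unfolding fcons_word[symmetric] tproj_meas_fcons H.L_bimod_simps
    by (intro klin_sweedler_param klin_comp[OF klin_tproj_fcons'] klin_measuring f that)
  moreover have "?G (ract H.L u a # v # ys) = ?G (u # lact H.L a v # ys)" if ys: "length ys = n" for u a v ys
  proof -
    have vys: "meas n z (word (v # ys)) \<in> fsums (Suc n)" for z
      by (rule f) (simp add: ys)
    define h where "h y z w = tproj H'.L (Suc (Suc n)) (fcons (\<Psi> y (tgt H a) * \<Psi> z u) (meas n w (word (v # ys))))"
      for y z w
    have lin: "Clin (\<lambda>y. h y z w)" "Clin (\<lambda>z. h y z w)" "Clin (\<lambda>w. h y z w)" for y z w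
      unfolding h_def
      by (intro klin_comp[OF klin_tproj_fcons'[OF vys]] klin_comp[OF klin_mult_left] klin_comp[OF klin_mult_right]
          klin_measuring_left klin_tproj_fcons_comp Clin_tproj_meas; use ys in simp)+
    have "?G (tgt H a * u # v # ys) = Csum x (\<lambda>p w. Csum p (\<lambda>y z. h y z w))"
      unfolding fcons_word[symmetric, of "tgt H a * u"] tproj_meas_fcons h_def
      by (intro sweedler_cong klin_measuring_mult klin_tproj_fcons' vys)
    also have "\<dots> = Csum x (\<lambda>y p. Csum p (\<lambda>z w. h y z w))"
      by (rule Csum_coassoc) (rule lin)+
    \<comment> \<open>That reunion requires the leg acting on t(a) to stand next to the later ones,
      so it is moved past the leg acting on \<open>u\<close>.\<close>
    also have "\<dots> = Csum x (\<lambda>y p. Csum p (\<lambda>z w. h z y w))"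
      by (rule Csum_swap12) (rule lin)+
    also have "\<dots> = Csum x (\<lambda>y p. Csum p (\<lambda>z w. tproj H'.L (Suc (Suc n))
        (fcons (\<Psi> y u) (map_head ((*) (\<Psi> z (src H a))) (meas n w (word (v # ys)))))))"
      using tproj_fcons_swap[OF vys, of H'.L] by (simp add: h_def measuring_src measuring_tgt H'.L_bimod_simps(2)[abs_def])
    also have "\<dots> = Csum x (\<lambda>y p. tproj H'.L (Suc (Suc n)) (fcons (\<Psi> y u)
        (Csum p (\<lambda>z w. map_head ((*) (\<Psi> z (src H a))) (meas n w (word (v # ys)))))))"
      by (simp add: klin_sweedler_comp[OF klin_tproj_comp[OF klin_fcons]])
    also have "\<dots> = ?G (u # src H a * v # ys)"
      unfolding fcons_word[symmetric, of u] tproj_meas_fcons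
      by (intro sweedler_cong tproj_fcons_cong)
        (simp only: tproj_meas_lact[OF ys] klin_sweedler_comp[OF klin_tproj])
    finally show ?thesis by simp
  qed
  moreover have "balanced H.L (Suc n) (\<lambda>w. ?G (u # w))" for u
    unfolding fcons_word[symmetric, of u] tproj_meas_fcons
    by (intro balanced_sweedler balanced_tproj_factor[OF klin_tproj_comp[OF klin_fcons] _ Suc.IH])
      (use balanced_tproj[of H'.L "Suc (Suc n)"] in simp)
  ultimately show ?case unfolding balanced.simps(2)[of H.L "Suc n"] by blast
qed

lemma tproj_meas_cong:
  "tproj H.L (Suc n) p = tproj H.L (Suc n) q \<Longrightarrow>
    tproj H'.L (Suc n) (meas n x p) = tproj H'.L (Suc n) (meas n x q)"
  by (rule klin_tproj_cong[OF klin_tproj_comp[OF klin_meas] balanced_tproj_meas])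

lemma sweedler_measuring:
  assumes "balanced2 H'.L g"
  shows "sweedler H'.\<Delta> (\<Psi> x u) g = sweedler H.\<Delta> u (\<lambda>v w. Csum x (\<lambda>y z. g (\<Psi> y v) (\<Psi> z w)))"
  unfolding H'.sweedler_tclass[OF assms comult_measuring]
  by (subst sweedler_swap, unfold sweedler_def fbilin_def flin_flin flin_word_arg,
      rule flin_fsums_cong[OF trep_comult_in_fsums], rule flin_fsums_cong[OF H.trep_comult_in_fsums])
    (simp add: numeral_2_eq_2)

lemma tproj_meas_iter_comult:
  "tproj H'.L (Suc n) (meas n x (iter_comult H.\<Delta> n u)) = tproj H'.L (Suc n) (iter_comult H'.\<Delta> n (\<Psi> x u))"
proof (induction n arbitrary: x u)
  case 0
  show ?case by simp
next
  case (Suc n)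
  have "tproj H'.L (Suc (Suc n)) (meas (Suc n) x (iter_comult H.\<Delta> (Suc n) u))
    = sweedler H.\<Delta> u (\<lambda>v w. Csum x (\<lambda>y z. tproj H'.L (Suc (Suc n)) (fcons (\<Psi> y v) (meas n z (iter_comult H.\<Delta> n w)))))"
    unfolding iter_comult_Suc klin_sweedler_comp[OF klin_tproj_comp[OF klin_meas]] tproj_meas_fcons ..
  also have "\<dots> = sweedler H.\<Delta> u (\<lambda>v w. Csum x (\<lambda>y z. tproj H'.L (Suc (Suc n)) (fcons (\<Psi> y v) (iter_comult H'.\<Delta> n (\<Psi> z w)))))"
    by (intro sweedler_cong tproj_fcons_cong Suc.IH)
  also have "\<dots> = tproj H'.L (Suc (Suc n)) (iter_comult H'.\<Delta> (Suc n) (\<Psi> x u))"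
    unfolding iter_comult_Suc klin_sweedler_comp[OF klin_tproj] sweedler_measuring[OF H'.balanced2_iter_comult] ..
  finally show ?case .
qed

lemma tproj_meas_xi_word:
  assumes "length us = Suc n"
  shows "tproj H'.L (Suc n) (meas n x (xi_word H.\<Delta> us))
    = tproj H'.L (Suc n) (flin (xi_word H'.\<Delta>) (meas n x (word us)))"
  using assms
proof (induction n arbitrary: us x)
  case 0
  then obtain u where "us = [u]" by (cases us) auto
  then show ?case by (simp add: xi_word_Cons)
next
  case (Suc n)
  then obtain u vs where us: "us = u # vs" "length vs = Suc n" by (cases us) auto
  let ?T = "tproj H'.L (Suc (Suc n))"
  have q: "xi_word H.\<Delta> vs \<in> fsums (Suc n)" "fcons 1 (xi_word H.\<Delta> vs) \<in> fsums (Suc (Suc n))"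
    using xi_word_in_fsums[of H.\<Delta> vs] us by auto
  \<comment> \<open>\<open>xi_word\<close> reads the number of legs off the length of the tail, so
    the formula holds only for tails of length \<open>Suc n\<close>.\<close>
  have xi_fcons: "flin (xi_word H'.\<Delta>) (fcons v p) = fmult (iter_comult H'.\<Delta> (Suc n) v) (fcons 1 (flin (xi_word H'.\<Delta>) p))"
    if "p \<in> fsums (Suc n)" for v p
    by (rule klin_fsums_eqI[OF _ _ that])
      (auto simp: xi_word_Cons intro!: klin_flin_comp klin_fcons klin_fbilin_right_comp klin_fcons_comp klin_flin)
  have "?T (meas (Suc n) x (xi_word H.\<Delta> us))
    = Csum x (\<lambda>y z. ?T (fmult (meas (Suc n) y (iter_comult H.\<Delta> (Suc n) u)) (meas (Suc n) z (fcons 1 (xi_word H.\<Delta> vs)))))"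
    unfolding us xi_word_Cons using us
    by (simp add: tproj_meas_fmult iter_comult_in_fsums q)
  \<comment> \<open>The order matters: the left factor, which may always be changed, first becomes
    an iterated coproduct of the target; only then may the right factor be changed modulo the
    relations.\<close>
  also have "\<dots> = Csum x (\<lambda>y z. ?T (fmult (iter_comult H'.\<Delta> (Suc n) (\<Psi> y u)) (meas (Suc n) z (fcons 1 (xi_word H.\<Delta> vs)))))"
    by (intro sweedler_cong H'.fmult_left_cong tproj_meas_iter_comult meas_in_fsums q)
  also have "\<dots> = Csum x (\<lambda>y z. ?T (fmult (iter_comult H'.\<Delta> (Suc n) (\<Psi> y u)) (fcons 1 (meas n z (xi_word H.\<Delta> vs)))))"
    by (intro sweedler_cong H'.fmult_iter_comult_cong tproj_meas_fcons_one q) simp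
  also have "\<dots> = Csum x (\<lambda>y z. ?T (fmult (iter_comult H'.\<Delta> (Suc n) (\<Psi> y u))
      (fcons 1 (flin (xi_word H'.\<Delta>) (meas n z (word vs))))))"
    by (intro sweedler_cong H'.fmult_iter_comult_cong tproj_fcons_cong Suc.IH us)
  also have "\<dots> = Csum x (\<lambda>y z. ?T (flin (xi_word H'.\<Delta>) (fcons (\<Psi> y u) (meas n z (word vs)))))"
    by (subst xi_fcons) (auto intro: meas_in_fsums simp: us)
  also have "\<dots> = ?T (flin (xi_word H'.\<Delta>) (meas (Suc n) x (word us)))"
    unfolding us fcons_word[symmetric] meas_fcons klin_sweedler_comp[OF klin_tproj_comp[OF klin_flin]] ..
  finally show ?case .
qed

lemma tproj_meas_flin_xi_word:
  assumes "p \<in> fsums (Suc n)"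
  shows "tproj H'.L (Suc n) (meas n x (flin (xi_word H.\<Delta>) p))
    = tproj H'.L (Suc n) (flin (xi_word H'.\<Delta>) (meas n x p))"
  by (rule klin_fsums_eqI[OF _ _ assms])
    (auto intro!: klin_tproj_comp klin_meas_comp klin_flin klin_flin_comp klin_meas simp: tproj_meas_xi_word)

end

section \<open>Maps on equivalence classes\<close>

lemma self_in_tclass: "p \<in> fsums n \<Longrightarrow> p \<in> tclass M n p"
  by (simp add: tclass_def tensor_eq_iff)

lemma tinduced_tclass:
  assumes "p \<in> fsums m" "\<And>q. q \<in> fsums m \<Longrightarrow> F q \<in> fsums n"
    and "\<And>q. q \<in> fsums m \<Longrightarrow> tproj M m p = tproj M m q \<Longrightarrow> tproj N n (F p) = tproj N n (F q)"
  shows "tinduced N n F (tclass M m p) = tclass N n (F p)"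
proof -
  have "tclass N n (F q) = tclass N n (F p)" if "q \<in> tclass M m p" for q
  proof (rule tclass_eqI)
    have q: "q \<in> fsums m" "tproj M m p = tproj M m q"
      using that by (simp_all add: tclass_def tensor_eq_iff)
    show "F q \<in> fsums n" "F p \<in> fsums n" by (intro assms q)+
    show "tproj N n (F q) = tproj N n (F p)" by (rule assms(3)[symmetric]) (rule q)+
  qed
  then show ?thesis
    using self_in_tclass[OF assms(1)] unfolding tinduced_def by blast
qed

text \<open>\<open>tinduced\<close> is a union over all representatives, so the inner class can be
  evaluated at the single representative \<open>F p\<close>. Keeping the union over \<open>p\<close>
  makes the invariance of the outer map \<open>G\<close> the only one to check.\<close>

lemma tinduced_tinduced:
  assumes "X \<subseteq> fsums n" "\<And>p. p \<in> fsums n \<Longrightarrow> F p \<in> fsums n" "\<And>q. q \<in> fsums n \<Longrightarrow> G q \<in> fsums n"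
    and "\<And>p q. tproj M n p = tproj M n q \<Longrightarrow> tproj N n (G p) = tproj N n (G q)"
  shows "tinduced N n G (tinduced M n F X) = (\<Union>p\<in>X. tclass N n (G (F p)))"
proof -
  have "tinduced N n G (tinduced M n F X) = (\<Union>p\<in>X. tinduced N n G (tclass M n (F p)))"
    by (simp add: tinduced_def)
  also have "\<dots> = (\<Union>p\<in>X. tclass N n (G (F p)))"
    by (intro SUP_cong refl tinduced_tclass) (use assms in blast)+
  finally show ?thesis .
qed

theorem proposition3p4:
  fixes H :: "('k::field, 'u::{ring, monoid_mult}, 'a::{ring, monoid_mult}) hopf_algebroid_data"
    and H' :: "('k, 'v::{ring, monoid_mult}, 'b::{ring, monoid_mult}) hopf_algebroid_data"
    and C :: "('k, 'c::ab_group_add) coalgebra_data"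
    and \<Psi> :: "'c \<Rightarrow> 'u \<Rightarrow> 'v" and \<psi> :: "'c \<Rightarrow> 'a \<Rightarrow> 'b"
    and x :: 'c and n :: nat
  assumes "hopf_algebroid H" and "hopf_algebroid H'"
    and "cocommutative_coalgebra C"
    and "hopf_measuring C H H' \<Psi> \<psi>"
  shows "\<forall>z\<in>C_lower H n.
    (Psi_upper C H' \<Psi> \<psi> n x \<circ> xi H n) z = (xi H' n \<circ> Psi_lower C H' \<Psi> \<psi> n x) z"
proof (cases n)
  case 0
  \<comment> \<open>In degree 0 every chain is an \<open>Inl\<close>, on which \<xi> is the identity
    and both induced maps are \<open>\<psi> x\<close>.\<close>
  then show ?thesis
    by (auto simp: C_lower_def Psi_upper_def Psi_lower_def xi_def)
next
  case (Suc m)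
  interpret H: hopf_algebroid H by (rule assms)
  interpret H': hopf_algebroid H' by (rule assms)
  interpret C: cocommutative_coalgebra C by (rule assms)
  interpret m: hopf_measuring C H H' \<Psi> \<psi> by (rule assms)
  interpret bialgebroid_measuring C H H' \<Psi> \<psi>
    by unfold_locales (use m.measuring_in_V m.measuring_comult in \<open>auto simp: V_def\<close>)
  \<comment> \<open>\<open>measure_fsum\<close> is indexed by the word length, \<open>meas\<close>
    by the number of splittings of \<open>x\<close>, which is one less.\<close>
  have meas: "measure_fsum C \<Psi> n x = meas m x"
    by (simp add: fun_eq_iff measure_fsum_def meas_def Suc)
  have xi_closed: "flin (xi_word D) p \<in> fsums n" if "p \<in> fsums n"
    for D and p :: "('k, 'w::{ring, monoid_mult}) fsum"
    by (rule flin_in_fsums'[OF that]) (use xi_word_in_fsums in auto)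
  show ?thesis
  proof
    fix z assume "z \<in> C_lower H n"
    then obtain X where z: "z = Inr X" "X \<in> tensor_power (R_bimod H) n"
      by (auto simp: C_lower_def Suc)
    have X: "X \<subseteq> fsums n" by (rule tensor_power_subset[OF z(2)])
    have "tinduced H'.L n (meas m x) (tinduced H.L n (flin (xi_word H.\<Delta>)) X)
      = (\<Union>p\<in>X. tclass H'.L n (meas m x (flin (xi_word H.\<Delta>) p)))"
      using X unfolding Suc
      by (intro tinduced_tinduced xi_closed[unfolded Suc] meas_in_fsums tproj_meas_cong)
    also have "\<dots> = (\<Union>p\<in>X. tclass H'.L n (flin (xi_word H'.\<Delta>) (meas m x p)))"
    proof (intro SUP_cong refl tclass_eqI)
      fix p assume "p \<in> X"
      with X have p: "p \<in> fsums (Suc m)" by (auto simp: Suc)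
      show "meas m x (flin (xi_word H.\<Delta>) p) \<in> fsums n" "flin (xi_word H'.\<Delta>) (meas m x p) \<in> fsums n"
        unfolding Suc by (intro meas_in_fsums xi_closed[unfolded Suc] p)+
      show "tproj H'.L n (meas m x (flin (xi_word H.\<Delta>) p)) = tproj H'.L n (flin (xi_word H'.\<Delta>) (meas m x p))"
        unfolding Suc by (rule tproj_meas_flin_xi_word[OF p])
    qed
    also have "\<dots> = tinduced H'.L n (flin (xi_word H'.\<Delta>)) (tinduced (R_bimod H') n (meas m x) X)"
      using X unfolding Suc
      by (intro tinduced_tinduced[symmetric] xi_closed[unfolded Suc] meas_in_fsums H'.flin_xi_word_cong)
    finally show "(Psi_upper C H' \<Psi> \<psi> n x \<circ> xi H n) z = (xi H' n \<circ> Psi_lower C H' \<Psi> \<psi> n x) z"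
      by (simp add: z Psi_upper_def Psi_lower_def xi_def meas)
  qed
qed

end
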